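(* Let $K_N$ be the coefficient matrix of the linear system for the discrete pressure in the staggered semi-implicit discontinuous Galerkin discretization, with basis functions of degree $p$ in each variable, of the two-dimensional incompressible Navier-Stokes equations on a Cartesian grid of $n_1\times n_2$ elements. Write $\mathbf n=(n_1,n_2)$, $\hat n=n_1n_2$, $s=(p+1)^2$ and $N=(p+1)^2\hat n$. This matrix is symmetric and has the form $$K_N=T_{\mathbf n}(f)+E_{\mathbf n},$$ where $T_{\mathbf n}(f)$ is the $2$-level block Toeplitz matrix generated by the Hermitian $s\times s$ matrix-valued symbol $$f(\theta_1,\theta_2)=\hat f_{(0,0)}+\hat f_{(-1,0)}e^{-\mathrm{i}\theta_1}+\hat f_{(0,-1)}e^{-\mathrm{i}\theta_2}+\hat f_{(1,0)}e^{\mathrm{i}\theta_1}+\hat f_{(0,1)}e^{\mathrm{i}\theta_2},\qquad(\theta_1,\theta_2)\in(-\pi,\pi)^2,$$ whose coefficients are the specific real $s\times s$ matrices of the discretization (given in the context), satisfying $\hat f_{(0,0)}^T=\hat f_{(0,0)}$, $\hat f_{(-1,0)}^T=\hat f_{(1,0)}$, $\hat f_{(0,-1)}^T=\hat f_{(0,1)}$, and where $E_{\mathbf n}$ is a low-rank perturbation whose rank grows at most proportionally to $\sqrt{\hat n}$, with constant depending on the bandwidths of $K_N$. For this matrix-sequence, $$\{K_N\}_N\sim_\lambda(f,(-\pi,\pi)^2),$$ that is, $\{K_N\}_N$ is distributed as the pair $(f,(-\pi,\pi)^2)$ in the sense of the eigenvalues.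
   Context: The discretization. The equations are $\nabla\cdot\mathbf v=0$ and $\partial_t\mathbf v+\nabla\cdot(\mathbf v\otimes\mathbf v)+\nabla P=\nabla\cdot(\nu\nabla\mathbf v)$, where $\mathbf v$ is the velocity, $P$ the pressure and $\nu$ the viscosity. The discrete pressure is a piecewise polynomial on the main Cartesian grid. The velocity components are piecewise polynomials on edge-based staggered grids: the first component lives on elements shifted by half an element in $x$, the second on elements shifted by half an element in $y$. The convective terms are explicit and the pressure gradient is implicit. The discrete momentum equations are substituted into the discrete continuity equation, which gives the pressure system; $K_N$ is its coefficient matrix. This is the method of Fambri and Dumbser on staggered Cartesian grids. Let $\varphi_0,\dots,\varphi_p$ be the nodal Lagrange basis of degree $p$ on $[0,1]$ with equispaced nodes (the constant $1$ if $p=0$). Define the $(p+1)\times(p+1)$ matrices $$M_{kl}=\int_0^1\varphi_k\varphi_l\,d\xi,\qquad R_{kl}=\varphi_k(\tfrac12)\varphi_l(0)+\int_{1/2}^1\varphi_k(\xi)\varphi_l'(\xi-\tfrac12)\,d\xi,$$ $$L_{kl}=\varphi_k(\tfrac12)\varphi_l(1)-\int_0^{1/2}\varphi_k(\xi)\varphi_l'(\xi+\tfrac12)\,d\xi,$$ $$H_R=-L^TM^{-1}R,\qquad H_L=-R^TM^{-1}L,\qquad C=L^TM^{-1}L+R^TM^{-1}R .$$ With the scaling $\delta\tau/\Delta x^2=\delta\tau/\Delta y^2=1$ (where $\delta\tau,\Delta x,\Delta y$ are the time and space steps), the row of blocks of $K_N$ for an interior element $(i,j)$, $2\le i\le n_1-1$,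 $2\le j\le n_2-1$, couples the pressure unknowns of $(i,j)$, $(i\pm1,j)$, $(i,j\pm1)$ through the blocks $$\hat f_{(0,0)}=C\otimes M+M\otimes C,\quad \hat f_{(-1,0)}=H_R\otimes M,\quad \hat f_{(1,0)}=H_L\otimes M,\quad \hat f_{(0,-1)}=M\otimes H_R,\quad \hat f_{(0,1)}=M\otimes H_L,$$ where $\hat f_{(0,0)}$ multiplies the unknowns of $(i,j)$, $\hat f_{(\mp1,0)}$ those of $(i\pm1,j)$ and $\hat f_{(0,\mp1)}$ those of $(i,j\pm1)$. The perturbation $E_{\mathbf n}=K_N-T_{\mathbf n}(f)$ comes from the elements adjacent to the boundary of the domain, through the boundary conditions (Dirichlet pressure conditions in the source's computations with $K_N$). For $p=2$ these are $$M=\frac1{30}\begin{pmatrix}4&2&-1\\2&16&2\\-1&2&4\end{pmatrix},\quad C=\frac1{96}\begin{pmatrix}127&-2&-65\\-2&316&-2\\-65&-2&127\end{pmatrix},\quad H_R=\frac1{192}\begin{pmatrix}25&46&-11\\-170&-188&46\\-35&-170&25\end{pmatrix},\quad H_L=H_R^T .$$ Toeplitz matrices. $T_{\mathbf n}(f)=\sum_{j_1=-(n_1-1)}^{n_1-1}\sum_{j_2=-(n_2-1)}^{n_2-1}J_{n_1}^{j_1}\otimes J_{n_2}^{j_2}\otimes\hat f_{(j_1,j_2)}$, where $\hat f_{\mathbf j}$ are the Fourier coefficients of $f$ (zero except for the five above) and $J_m^{j}$ is the $m\times m$ matrix whose $(i,h)$ entry is $1$ if $i-h=j$ and $0$ otherwise.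 Eigenvalue distribution. Let $G\subset\mathbb R^\ell$ be measurable with Lebesgue measure $0<m_\ell(G)<\infty$, let $g:G\to\mathbb C^{s\times s}$ be measurable, and let $A_{\mathbf n}$ be a square matrix of size $N=N(\mathbf n)$ with eigenvalues $\lambda_1(A_{\mathbf n}),\dots,\lambda_N(A_{\mathbf n})$. One writes $\{A_{\mathbf n}\}\sim_\lambda(g,G)$ if for every continuous compactly supported $F$ on $\mathbb C$ $$\lim_{\mathbf n\to\infty}\frac1N\sum_{j=1}^NF(\lambda_j(A_{\mathbf n}))=\frac1{m_\ell(G)}\int_G\frac{\operatorname{tr}(F(g(\theta)))}{s}\,d\theta,$$ where $\operatorname{tr}(F(g(\theta)))$ is the sum of $F$ over the $s$ eigenvalues of $g(\theta)$ and $\mathbf n\to\infty$ means $\min_i n_i\to\infty$. The sequence $\{K_N\}_N$ is indexed by $\mathbf n\in\mathbb N^2$.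
   Formalization: The rank of E_n is bounded by c(n_1+n_2) in general and by a constant times sqrt(n_1 n_2) only for bounded aspect ratio, as the unrestricted bound fails; K_N is any symmetric matrix with the given interior block rows, its symmetry being assumed. *)

theory Defs
  imports
    "HOL-Analysis.Analysis"
    "HOL-Computational_Algebra.Computational_Algebra"
    "Jordan_Normal_Form.Char_Poly"
    "Jordan_Normal_Form.Schur_Decomposition"
    "Jordan_Normal_Form.Gauss_Jordan_Elimination"
    "Jordan_Normal_Form.DL_Rank"
begin

section \<open>Matrices\<close>

text \<open>HOL-Analysis and Jordan_Normal_Form both have a constant \<open>mat\<close>;
  the qualified name \<open>Matrix.mat\<close> is the one of Jordan_Normal_Form.\<close>

abbreviation cmat :: "real mat \<Rightarrow> complex mat" where
  "cmat \<equiv> map_mat complex_of_real"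

definition kron :: "'a::times mat \<Rightarrow> 'a mat \<Rightarrow> 'a mat" where
  "kron A B = Matrix.mat (dim_row A * dim_row B) (dim_col A * dim_col B)
     (\<lambda>(i, j). A $$ (i div dim_row B, j div dim_col B) * B $$ (i mod dim_row B, j mod dim_col B))"

definition eigenvalue_mset :: "complex mat \<Rightarrow> complex multiset" where
  "eigenvalue_mset A = proots (char_poly A)"

section \<open>Eigenvalue distribution\<close>

text \<open>\<open>eigenvalue_distributed F A s g G\<close> says that the matrix-sequence \<open>A\<close> is distributed as
  \<open>(g, G)\<close> in the sense of the eigenvalues, where \<open>F\<close> is the filter along which the
  multi-index tends to infinity and \<open>g\<close> takes values in the \<open>s\<close> by \<open>s\<close> matrices. The standing
  requirements on \<open>G\<close>, \<open>g\<close> and \<open>A\<close> are part of the predicate.\<close>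

definition eigenvalue_distributed ::
  "'i filter \<Rightarrow> ('i \<Rightarrow> complex mat) \<Rightarrow> nat \<Rightarrow> ('b::euclidean_space \<Rightarrow> complex mat) \<Rightarrow> 'b set \<Rightarrow> bool"
where
  "eigenvalue_distributed F A s g G \<longleftrightarrow>
     G \<in> lmeasurable \<and> 0 < measure lebesgue G \<and>
     (\<forall>\<theta>\<in>G. g \<theta> \<in> carrier_mat s s) \<and>
     (\<forall>k<s. \<forall>l<s. (\<lambda>\<theta>. g \<theta> $$ (k, l)) \<in> borel_measurable (lebesgue_on G)) \<and>
     (\<forall>\<^sub>F n in F. square_mat (A n)) \<and>
     (\<forall>\<Phi> :: complex \<Rightarrow> complex.
        continuous_on UNIV \<Phi> \<and> compact (closure {z. \<Phi> z \<noteq> 0}) \<longrightarrow>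
        ((\<lambda>n. (\<Sum>z\<in>#eigenvalue_mset (A n). \<Phi> z) / of_nat (dim_row (A n)))
          \<longlongrightarrow> (LINT \<theta>|lebesgue_on G. (\<Sum>z\<in>#eigenvalue_mset (g \<theta>). \<Phi> z) / of_nat s)
                / complex_of_real (measure lebesgue G)) F)"

definition min_at_top :: "(nat \<times> nat) filter" where
  "min_at_top = filtercomap (\<lambda>(n1, n2). min n1 n2) at_top"

section \<open>Two-level block Toeplitz matrices\<close>

definition symbol_domain :: "(real \<times> real) set" where
  "symbol_domain = {-pi<..<pi} \<times> {-pi<..<pi}"

definition fourier_coeff :: "nat \<Rightarrow> (real \<times> real \<Rightarrow> complex mat) \<Rightarrow> int \<times> int \<Rightarrow> complex mat" where
  "fourier_coeff s f = (\<lambda>(j1, j2). Matrix.mat s s (\<lambda>(k, l).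
     (LINT (\<theta>1, \<theta>2)|lebesgue_on symbol_domain.
        f (\<theta>1, \<theta>2) $$ (k, l) * exp (- (\<i> * complex_of_real (of_int j1 * \<theta>1 + of_int j2 * \<theta>2))))
     / complex_of_real ((2 * pi)\<^sup>2)))"

definition shift_mat :: "nat \<Rightarrow> int \<Rightarrow> complex mat" where
  "shift_mat m j = Matrix.mat m m (\<lambda>(i, h). if int i - int h = j then 1 else 0)"

text \<open>The sum of matrices is taken entrywise, as Jordan_Normal_Form matrices of a given size do
  not form a type.\<close>

definition toeplitz2 :: "nat \<Rightarrow> nat \<Rightarrow> nat \<Rightarrow> (real \<times> real \<Rightarrow> complex mat) \<Rightarrow> complex mat" where
  "toeplitz2 s n1 n2 f = Matrix.mat (n1 * n2 * s) (n1 * n2 * s) (\<lambda>(r, c).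
     \<Sum>j1 = - (int n1 - 1)..int n1 - 1. \<Sum>j2 = - (int n2 - 1)..int n2 - 1.
       kron (kron (shift_mat n1 j1) (shift_mat n2 j2)) (fourier_coeff s f (j1, j2)) $$ (r, c))"

section \<open>The staggered discontinuous Galerkin discretization\<close>

text \<open>For \<open>p = 0\<close> the product is empty, so the only basis function is the constant 1.\<close>

definition lagrange_basis :: "nat \<Rightarrow> nat \<Rightarrow> real \<Rightarrow> real" where
  "lagrange_basis p k \<xi> =
     (\<Prod>j\<in>{..p} - {k}. (\<xi> - real j / real p) / (real k / real p - real j / real p))"

definition M_mat :: "nat \<Rightarrow> real mat" where
  "M_mat p = Matrix.mat (p + 1) (p + 1) (\<lambda>(k, l).
     integral {0..1} (\<lambda>\<xi>. lagrange_basis p k \<xi> * lagrange_basis p l \<xi>))"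

definition R_mat :: "nat \<Rightarrow> real mat" where
  "R_mat p = Matrix.mat (p + 1) (p + 1) (\<lambda>(k, l).
     lagrange_basis p k (1/2) * lagrange_basis p l 0
     + integral {1/2..1} (\<lambda>\<xi>. lagrange_basis p k \<xi> * deriv (lagrange_basis p l) (\<xi> - 1/2)))"

definition L_mat :: "nat \<Rightarrow> real mat" where
  "L_mat p = Matrix.mat (p + 1) (p + 1) (\<lambda>(k, l).
     lagrange_basis p k (1/2) * lagrange_basis p l 1
     - integral {0..1/2} (\<lambda>\<xi>. lagrange_basis p k \<xi> * deriv (lagrange_basis p l) (\<xi> + 1/2)))"

text \<open>\<open>M_mat p\<close> is the Gram matrix of a basis, so \<open>mat_inverse\<close> does return its inverse.\<close>

definition M_inv :: "nat \<Rightarrow> real mat" where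
  "M_inv p = the (mat_inverse (M_mat p))"

definition HR_mat :: "nat \<Rightarrow> real mat" where
  "HR_mat p = - (transpose_mat (L_mat p) * M_inv p * R_mat p)"

definition HL_mat :: "nat \<Rightarrow> real mat" where
  "HL_mat p = - (transpose_mat (R_mat p) * M_inv p * L_mat p)"

definition C_mat :: "nat \<Rightarrow> real mat" where
  "C_mat p = transpose_mat (L_mat p) * M_inv p * L_mat p
           + transpose_mat (R_mat p) * M_inv p * R_mat p"

abbreviation block_size :: "nat \<Rightarrow> nat" where
  "block_size p \<equiv> (p + 1)\<^sup>2"

definition dg_coeff :: "nat \<Rightarrow> int \<times> int \<Rightarrow> real mat" where
  "dg_coeff p j =
     (if j = (0, 0) then kron (C_mat p) (M_mat p) + kron (M_mat p) (C_mat p)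
      else if j = (-1, 0) then kron (HR_mat p) (M_mat p)
      else if j = (1, 0) then kron (HL_mat p) (M_mat p)
      else if j = (0, -1) then kron (M_mat p) (HR_mat p)
      else if j = (0, 1) then kron (M_mat p) (HL_mat p)
      else 0\<^sub>m (block_size p) (block_size p))"

definition dg_symbol :: "nat \<Rightarrow> real \<times> real \<Rightarrow> complex mat" where
  "dg_symbol p = (\<lambda>(\<theta>1, \<theta>2).
     cmat (dg_coeff p (0, 0))
     + exp (- (\<i> * complex_of_real \<theta>1)) \<cdot>\<^sub>m cmat (dg_coeff p (-1, 0))
     + exp (- (\<i> * complex_of_real \<theta>2)) \<cdot>\<^sub>m cmat (dg_coeff p (0, -1))
     + exp (\<i> * complex_of_real \<theta>1) \<cdot>\<^sub>m cmat (dg_coeff p (1, 0))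
     + exp (\<i> * complex_of_real \<theta>2) \<cdot>\<^sub>m cmat (dg_coeff p (0, 1)))"

text \<open>Elements are numbered \<open>(i, j)\<close> with \<open>i < n1\<close>, \<open>j < n2\<close> (from 0), ordered
  lexicographically as in the Kronecker products of \<open>toeplitz2\<close>.\<close>

definition matrix_block ::
  "nat \<Rightarrow> nat \<Rightarrow> real mat \<Rightarrow> nat \<times> nat \<Rightarrow> nat \<times> nat \<Rightarrow> real mat" where
  "matrix_block s n2 K = (\<lambda>(i, j) (i', j'). Matrix.mat s s (\<lambda>(k, l).
     K $$ ((i * n2 + j) * s + k, (i' * n2 + j') * s + l)))"

text \<open>\<open>K\<close> is a coefficient matrix of the discrete pressure system, scaled so that
  \<open>\<delta>\<tau>/\<Delta>x\<^sup>2 = \<delta>\<tau>/\<Delta>y\<^sup>2 = 1\<close>: it is symmetric, and the rows of blocks of the interior elements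
  are those of the scheme. The rows of the elements adjacent to the boundary depend on the
  boundary conditions and are left free apart from the symmetry.\<close>

definition pressure_matrix :: "nat \<Rightarrow> nat \<Rightarrow> nat \<Rightarrow> real mat \<Rightarrow> bool" where
  "pressure_matrix p n1 n2 K \<longleftrightarrow>
     K \<in> carrier_mat (n1 * n2 * block_size p) (n1 * n2 * block_size p) \<and>
     transpose_mat K = K \<and>
     (\<forall>i j i' j'. 1 \<le> i \<and> i + 1 < n1 \<and> 1 \<le> j \<and> j + 1 < n2 \<and> i' < n1 \<and> j' < n2 \<longrightarrow>
        matrix_block (block_size p) n2 K (i, j) (i', j')
          = dg_coeff p (int i - int i', int j - int j'))"

end

(* Proof idea. Restricted to the interior elements, K_N coincides with a (skew) block circulant
   matrix that is diagonalized explicitly by the modes exp(-i a.theta) u, where theta runs through a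
   uniform grid of (-pi, pi)^2 and u through the eigenvectors of f(theta). Two Hermitian matrices
   that agree outside the rows and columns of an index set S have eigenvalue counting functions
   that differ by at most card S, whatever the size of the entries in those rows and columns. Here
   card S = O(n1 + n2) = o(N), so the eigenvalue average of K_N has the same limit as
   that of the circulant, which is a Riemann sum of the integral of tr F(f(theta)). The integrand is
   continuous by a Hoffman-Wielandt argument. *)

theory Submission
  imports Defs
begin

section \<open>Interlacing\<close>

text \<open>What shapes the proof is that \<open>pressure_matrix\<close> leaves the boundary rows
  free up to symmetry: their entries may grow arbitrarily with the grid, so no norm estimate of the
  perturbation is available and only its location can be used. Counting functions do not see size,
  and a compactly supported test function is within \<epsilon> of a step function with finitely many
  thresholds. A bound on the counts therefore controls the eigenvalue sum up to a multiple of
  \<open>card S\<close> whose factor depends only on the test function and \<epsilon>. The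
  comparison is with a matrix assembled from sampled eigenvectors of the symbol, not with the
  Toeplitz matrix, because its eigenvalues are known exactly and no asymptotic theorem on block
  Toeplitz matrices enters; \<open>toeplitz2\<close> occurs only in the rank decomposition. The
  eigenvalues of the symbol are never labelled continuously in \<theta>: continuity is proved for
  their symmetric sums, and the eigenvectors at different grid points are chosen
  independently.\<close>

text \<open>Gaussian elimination, one equation per induction step. Unknowns and equations are
  indexed by arbitrary finite sets, so that several families of constraints can later be joined in a
  sum type.\<close>

lemma underdetermined_nonzero_solution:
  fixes c :: "'e \<Rightarrow> 'i \<Rightarrow> 'a::field"
  assumes "finite E" "finite I" "card E < card I"
  shows "\<exists>v. (\<exists>x\<in>I. v x \<noteq> 0) \<and> (\<forall>e\<in>E. (\<Sum>x\<in>I. c e x * v x) = 0)"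
  using assms
proof (induction E arbitrary: I c rule: finite_induct)
  case empty
  then have "I \<noteq> {}" by auto
  then show ?case by (intro exI[of _ "\<lambda>_. 1"]) auto
next
  case (insert e E)
  show ?case
  proof (cases "\<forall>x\<in>I. c e x = 0")
    case True
    with insert.IH[of I c] insert.prems insert.hyps show ?thesis by auto
  next
    case False
    then obtain z where z: "z \<in> I" "c e z \<noteq> 0" by blast
    \<comment> \<open>Row reduction: the multiple of equation \<open>e\<close> that removes the
      pivot unknown \<open>z\<close> is subtracted from every other equation.\<close>
    define c' where "c' e' x = c e' x - c e' z * c e x / c e z" for e' x
    have "finite (I - {z})" "card E < card (I - {z})"
      using insert.prems insert.hyps z by auto
    from insert.IH[OF this, of c'] obtain v
      where v: "\<exists>x\<in>I - {z}. v x \<noteq> 0" "\<And>e'. e' \<in> E \<Longrightarrow> (\<Sum>x\<in>I - {z}. c' e' x * v x) = 0"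
      by blast
    define s where "s = (\<Sum>x\<in>I - {z}. c e x * v x)"
    \<comment> \<open>The pivot unknown is recovered from equation \<open>e\<close>: its value
      cancels the contribution \<open>s\<close> of the other unknowns.\<close>
    define u where "u = v(z := - s / c e z)"
    have split: "(\<Sum>x\<in>I. c e' x * u x) = (\<Sum>x\<in>I - {z}. c e' x * v x) - c e' z * s / c e z" for e'
    proof -
      have "(\<Sum>x\<in>I. c e' x * u x) = c e' z * u z + (\<Sum>x\<in>I - {z}. c e' x * u x)"
        using insert.prems z by (simp add: sum.remove)
      also have "(\<Sum>x\<in>I - {z}. c e' x * u x) = (\<Sum>x\<in>I - {z}. c e' x * v x)"
        by (rule sum.cong) (auto simp: u_def)
      finally show ?thesis by (simp add: u_def)
    qed
    have "(\<Sum>x\<in>I. c e' x * u x) = 0" if "e' \<in> E" for e'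
    proof -
      have "0 = (\<Sum>x\<in>I - {z}. c' e' x * v x)" using v(2)[OF that] by simp
      also have "\<dots> = (\<Sum>x\<in>I - {z}. c e' x * v x) - c e' z * s / c e z"
        by (simp add: c'_def s_def algebra_simps sum_subtractf sum_distrib_left sum_divide_distrib)
      finally show ?thesis using split by simp
    qed
    moreover have "(\<Sum>x\<in>I. c e x * u x) = 0" unfolding split using z by (simp add: s_def)
    moreover have "\<exists>x\<in>I. u x \<noteq> 0" using v(1) by (auto simp: u_def)
    ultimately show ?thesis by blast
  qed
qed

section \<open>Spectral expansions and counting functions\<close>

text \<open>With the vectors \<open>w j\<close> as columns of W, the conditions read W W^H = 1 and W
  diag(\<alpha>) W^H = A. The completeness form of unitarity is recorded because it is what Parseval
  needs and what a sum over Fourier modes delivers. Functions on index sets let the flat numbering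
  of the unknowns and the triples (element, element, local index) be treated alike.\<close>

definition spectral_family ::
  "'i set \<Rightarrow> ('i \<Rightarrow> 'i \<Rightarrow> complex) \<Rightarrow> 'j set \<Rightarrow> ('j \<Rightarrow> 'i \<Rightarrow> complex) \<Rightarrow> ('j \<Rightarrow> real) \<Rightarrow> bool" where
  "spectral_family I A J w \<alpha> \<longleftrightarrow> finite I \<and> finite J \<and> card J = card I \<and>
     (\<forall>x\<in>I. \<forall>y\<in>I. (\<Sum>j\<in>J. w j x * cnj (w j y)) = of_bool (x = y)) \<and>
     (\<forall>x\<in>I. \<forall>y\<in>I. (\<Sum>j\<in>J. complex_of_real (\<alpha> j) * (w j x * cnj (w j y))) = A x y)"

text \<open>The expansion is a direct hypothesis, rather than \<open>spectral_family\<close>, so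
  that the identity also applies to the Kronecker delta with all weights 1.\<close>

lemma quadratic_form_spectral:
  fixes w :: "'j \<Rightarrow> 'i \<Rightarrow> complex"
  assumes "\<And>x y. x \<in> I \<Longrightarrow> y \<in> I \<Longrightarrow> A x y = (\<Sum>j\<in>J. complex_of_real (\<alpha> j) * (w j x * cnj (w j y)))"
  shows "(\<Sum>x\<in>I. \<Sum>y\<in>I. cnj (v x) * A x y * v y)
       = complex_of_real (\<Sum>j\<in>J. \<alpha> j * (cmod (\<Sum>x\<in>I. cnj (w j x) * v x))\<^sup>2)"
proof -
  have "(\<Sum>x\<in>I. \<Sum>y\<in>I. cnj (v x) * A x y * v y)
      = (\<Sum>x\<in>I. \<Sum>y\<in>I. \<Sum>j\<in>J. of_real (\<alpha> j) * ((w j x * cnj (v x)) * (cnj (w j y) * v y)))"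
    using assms by (simp add: sum_distrib_left sum_distrib_right algebra_simps)
  also have "\<dots> = (\<Sum>x\<in>I. \<Sum>j\<in>J. \<Sum>y\<in>I. of_real (\<alpha> j) * ((w j x * cnj (v x)) * (cnj (w j y) * v y)))"
    by (intro sum.cong refl sum.swap)
  also have "\<dots> = (\<Sum>j\<in>J. \<Sum>x\<in>I. \<Sum>y\<in>I. of_real (\<alpha> j) * ((w j x * cnj (v x)) * (cnj (w j y) * v y)))"
    by (rule sum.swap)
  also have "\<dots> = (\<Sum>j\<in>J. of_real (\<alpha> j) * ((\<Sum>x\<in>I. w j x * cnj (v x)) * (\<Sum>y\<in>I. cnj (w j y) * v y)))"
    unfolding sum_product by (simp only: sum_distrib_left)
  also have "\<dots> = (\<Sum>j\<in>J. of_real (\<alpha> j * (cmod (\<Sum>x\<in>I. cnj (w j x) * v x))\<^sup>2))"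
  proof (rule sum.cong[OF refl])
    fix j
    have "(\<Sum>x\<in>I. w j x * cnj (v x)) = cnj (\<Sum>x\<in>I. cnj (w j x) * v x)" by simp
    then show "of_real (\<alpha> j) * ((\<Sum>x\<in>I. w j x * cnj (v x)) * (\<Sum>y\<in>I. cnj (w j y) * v y))
      = of_real (\<alpha> j * (cmod (\<Sum>x\<in>I. cnj (w j x) * v x))\<^sup>2)"
      unfolding of_real_mult complex_norm_square by (simp only: mult.commute)
  qed
  finally show ?thesis by simp
qed

text \<open>Parseval: the completeness relation is itself a spectral expansion, that of the
  identity.\<close>

lemma norm_spectral_family:
  assumes "spectral_family I A J w \<alpha>"
  shows "(\<Sum>x\<in>I. (cmod (v x))\<^sup>2) = (\<Sum>j\<in>J. (cmod (\<Sum>x\<in>I. cnj (w j x) * v x))\<^sup>2)"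
proof -
  have fin: "finite I" using assms by (simp add: spectral_family_def)
  have "(\<Sum>x\<in>I. \<Sum>y\<in>I. cnj (v x) * of_bool (x = y) * v y)
    = complex_of_real (\<Sum>j\<in>J. 1 * (cmod (\<Sum>x\<in>I. cnj (w j x) * v x))\<^sup>2)"
    by (rule quadratic_form_spectral) (use assms in \<open>simp add: spectral_family_def\<close>)
  moreover have "(\<Sum>x\<in>I. \<Sum>y\<in>I. cnj (v x) * of_bool (x = y) * v y)
      = complex_of_real (\<Sum>x\<in>I. (cmod (v x))\<^sup>2)"
  proof -
    have "(\<Sum>y\<in>I. cnj (v x) * of_bool (x = y) * v y) = of_real ((cmod (v x))\<^sup>2)" if "x \<in> I" for x
    proof -
      have "(\<Sum>y\<in>I. cnj (v x) * of_bool (x = y) * v y) = (\<Sum>y\<in>I. if x = y then cnj (v x) * v y else 0)"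
        by (intro sum.cong) auto
      then show ?thesis using fin that by (simp add: complex_norm_square mult.commute flip: of_real_power)
    qed
    then show ?thesis by simp
  qed
  ultimately show ?thesis by (simp flip: of_real_sum add: of_real_eq_iff del: of_real_sum of_real_power)
qed

text \<open>A vector that vanishes on \<open>S\<close> does not see the difference of the two matrices, and the
  dimension count leaves one whose Rayleigh quotient would have to be both below and not below \<open>t\<close>.\<close>

lemma eigenvalue_count_interlacing:
  assumes A: "spectral_family I A J w \<alpha>" and B: "spectral_family I B J' u \<beta>"
    and "S \<subseteq> I" and eq: "\<And>x y. x \<in> I - S \<Longrightarrow> y \<in> I - S \<Longrightarrow> A x y = B x y"
  shows "card {j\<in>J. \<alpha> j < t} \<le> card {j\<in>J'. \<beta> j < t} + card S"
proof (rule ccontr)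
  assume neg: "\<not> ?thesis"
  have fin: "finite I" "finite J" "finite J'" "finite S" "card J = card I"
    using A B \<open>S \<subseteq> I\<close> by (auto simp: spectral_family_def intro: finite_subset)
  define c where "c = case_sum (\<lambda>j x. cnj (w j x)) (case_sum (\<lambda>j x. cnj (u j x)) (\<lambda>s x. of_bool (x = s)))"
  \<comment> \<open>Three kinds of constraints on \<open>v\<close>: orthogonality to the
    \<open>w j\<close> with \<alpha> not below t, orthogonality to the \<open>u j\<close> with
    \<beta> below t, and vanishing on \<open>S\<close>. Their number is below \<open>card I\<close>
    exactly because the claimed inequality is assumed to fail.\<close>
  define E where "E = {j\<in>J. \<not> \<alpha> j < t} <+> ({j\<in>J'. \<beta> j < t} <+> S)"
  have "J = {j\<in>J. \<alpha> j < t} \<union> {j\<in>J. \<not> \<alpha> j < t}" by blast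
  then have "card J = card {j\<in>J. \<alpha> j < t} + card {j\<in>J. \<not> \<alpha> j < t}"
    using fin card_Un_disjoint[of "{j\<in>J. \<alpha> j < t}" "{j\<in>J. \<not> \<alpha> j < t}"] by auto
  then have "card E < card I"
    using neg fin unfolding E_def by (simp add: card_Plus)
  moreover have "finite E" using fin by (simp add: E_def)
  ultimately obtain v where v: "\<exists>x\<in>I. v x \<noteq> 0" "\<And>e. e \<in> E \<Longrightarrow> (\<Sum>x\<in>I. c e x * v x) = 0"
    using underdetermined_nonzero_solution[of E I c] fin by blast
  define p where "p j = (cmod (\<Sum>x\<in>I. cnj (w j x) * v x))\<^sup>2" for j
  define q where "q j = (cmod (\<Sum>x\<in>I. cnj (u j x) * v x))\<^sup>2" for j
  have p0: "p j = 0" if "j \<in> J" "\<not> \<alpha> j < t" for j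
    using v(2)[of "Inl j"] that by (auto simp: E_def c_def p_def)
  have q0: "q j = 0" if "j \<in> J'" "\<beta> j < t" for j
    using v(2)[of "Inr (Inl j)"] that by (auto simp: E_def c_def q_def)
  have vS: "v s = 0" if "s \<in> S" for s
  proof -
    have "(\<Sum>x\<in>I. of_bool (x = s) * v x) = 0"
      using v(2)[of "Inr (Inr s)"] that by (auto simp: E_def c_def)
    moreover have "(\<Sum>x\<in>I. of_bool (x = s) * v x) = (\<Sum>x\<in>I. if x = s then v x else 0)"
      by (intro sum.cong) auto
    ultimately show ?thesis using that fin \<open>S \<subseteq> I\<close> by auto
  qed
  have pos: "0 < (\<Sum>x\<in>I. (cmod (v x))\<^sup>2)"
    using v(1) fin by (auto intro!: sum_pos2)
  have np: "(\<Sum>x\<in>I. (cmod (v x))\<^sup>2) = (\<Sum>j\<in>J. p j)"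
    unfolding p_def by (rule norm_spectral_family[OF A])
  have nq: "(\<Sum>x\<in>I. (cmod (v x))\<^sup>2) = (\<Sum>j\<in>J'. q j)"
    unfolding q_def by (rule norm_spectral_family[OF B])
  have "complex_of_real (\<Sum>j\<in>J. \<alpha> j * p j) = (\<Sum>x\<in>I. \<Sum>y\<in>I. cnj (v x) * A x y * v y)"
    unfolding p_def
    by (rule quadratic_form_spectral[symmetric]) (use A in \<open>simp add: spectral_family_def\<close>)
  also have "\<dots> = (\<Sum>x\<in>I. \<Sum>y\<in>I. cnj (v x) * B x y * v y)"
  proof (intro sum.cong refl)
    fix x y assume "x \<in> I" "y \<in> I"
    then show "cnj (v x) * A x y * v y = cnj (v x) * B x y * v y"
      using vS[of x] vS[of y] eq[of x y] by (cases "x \<in> S"; cases "y \<in> S") auto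
  qed
  also have "\<dots> = complex_of_real (\<Sum>j\<in>J'. \<beta> j * q j)"
    unfolding q_def
    by (rule quadratic_form_spectral) (use B in \<open>simp add: spectral_family_def\<close>)
  finally have qf: "(\<Sum>j\<in>J. \<alpha> j * p j) = (\<Sum>j\<in>J'. \<beta> j * q j)"
    using of_real_eq_iff by blast
  \<comment> \<open>Strictness: only indices with \<alpha> below t carry weight, and Parseval with
    \<open>v\<close> nonzero provides at least one of them.\<close>
  have "(\<Sum>j\<in>J. \<alpha> j * p j) < (\<Sum>j\<in>J. t * p j)"
  proof (rule sum_strict_mono_ex1)
    show "\<forall>j\<in>J. \<alpha> j * p j \<le> t * p j"
      using p0 by (metis less_eq_real_def mult_right_mono mult_zero_right p_def zero_le_power2)
    have "\<exists>j\<in>J. p j \<noteq> 0" using pos np by (metis less_irrefl sum.neutral)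
    then obtain j where "j \<in> J" "p j \<noteq> 0" by blast
    moreover from this have "\<alpha> j < t" "p j > 0" using p0 by (auto simp: p_def)
    ultimately show "\<exists>j\<in>J. \<alpha> j * p j < t * p j" by (intro bexI[of _ j]) simp_all
  qed (use fin in simp)
  also have "(\<Sum>j\<in>J. t * p j) = (\<Sum>j\<in>J'. t * q j)"
    using np nq by (simp flip: sum_distrib_left)
  also have "\<dots> \<le> (\<Sum>j\<in>J'. \<beta> j * q j)"
  proof (rule sum_mono)
    fix j assume "j \<in> J'"
    then show "t * q j \<le> \<beta> j * q j"
      using q0[of j] by (cases "\<beta> j < t") (auto simp: q_def intro: mult_right_mono)
  qed
  finally show False using qf by simp
qed

section \<open>Sums over eigenvalues\<close>

text \<open>The interval is enlarged by 1 and \<delta> capped by 1: if one of two close points lies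
  in the support interval, both lie in the enlarged one; otherwise both values are 0.\<close>

lemma compact_support_uniformly_continuous:
  fixes \<phi> :: "real \<Rightarrow> 'a::real_normed_vector"
  assumes cont: "continuous_on UNIV \<phi>" and supp: "\<And>x. R < \<bar>x\<bar> \<Longrightarrow> \<phi> x = 0" and "0 < \<epsilon>"
  obtains \<delta> where "0 < \<delta>" "\<And>x y. \<bar>x - y\<bar> < \<delta> \<Longrightarrow> norm (\<phi> x - \<phi> y) < \<epsilon>"
proof -
  have "uniformly_continuous_on {- R - 1..R + 1} \<phi>"
    by (intro compact_uniformly_continuous continuous_on_subset[OF cont]) auto
  then obtain \<delta> where \<delta>: "0 < \<delta>"
    "\<And>x y. x \<in> {- R - 1..R + 1} \<Longrightarrow> y \<in> {- R - 1..R + 1} \<Longrightarrow> dist y x < \<delta> \<Longrightarrow> dist (\<phi> y) (\<phi> x) < \<epsilon>"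
    using \<open>0 < \<epsilon>\<close> unfolding uniformly_continuous_on_def by metis
  show ?thesis
  proof (rule that[of "min \<delta> 1"])
    show "0 < min \<delta> 1" using \<delta> by simp
    fix x y :: real assume d: "\<bar>x - y\<bar> < min \<delta> 1"
    show "norm (\<phi> x - \<phi> y) < \<epsilon>"
    proof (cases "\<bar>x\<bar> \<le> R \<or> \<bar>y\<bar> \<le> R")
      case True
      then have "x \<in> {- R - 1..R + 1}" "y \<in> {- R - 1..R + 1}" using d by auto
      from \<delta>(2)[OF this(2,1)] d show ?thesis by (simp add: dist_norm)
    next
      case False
      then show ?thesis using supp[of x] supp[of y] \<open>0 < \<epsilon>\<close> by auto
    qed
  qed
qed

lemma compact_support_bounded:
  fixes \<phi> :: "real \<Rightarrow> 'a::real_normed_vector"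
  assumes cont: "continuous_on UNIV \<phi>" and supp: "\<And>x. R < \<bar>x\<bar> \<Longrightarrow> \<phi> x = 0"
  obtains B where "0 \<le> B" "\<And>x. norm (\<phi> x) \<le> B"
proof -
  have "compact (\<phi> ` {- R..R})"
    by (intro compact_continuous_image continuous_on_subset[OF cont]) auto
  then obtain B where B: "\<And>x. x \<in> {- R..R} \<Longrightarrow> norm (\<phi> x) \<le> B"
    using compact_imp_bounded[of "\<phi> ` {- R..R}"] unfolding bounded_iff by (metis imageI)
  \<comment> \<open>For negative \<open>R\<close> the interval is empty and \<open>B\<close> is an
    arbitrary real, hence the maximum with 0.\<close>
  show ?thesis
  proof (rule that[of "max B 0"])
    fix x show "norm (\<phi> x) \<le> max B 0"
      using B[of x] supp[of x] by (cases "\<bar>x\<bar> \<le> R") (auto simp: abs_le_iff)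
  qed simp
qed

text \<open>A step function built from indicators of half-open cells has a sum over eigenvalues that
  depends only on counts at the cell ends. The order of quantifiers is essential: \<open>C\<close>
  is fixed before the index sets, so \<open>C * r\<close> becomes negligible when the number of
  eigenvalues grows faster than \<open>r\<close>.\<close>

lemma sum_bound_from_counts:
  fixes \<phi> :: "real \<Rightarrow> complex" and \<epsilon> :: real
  assumes cont: "continuous_on UNIV \<phi>" and supp: "\<And>x. R < \<bar>x\<bar> \<Longrightarrow> \<phi> x = 0" and "0 < \<epsilon>"
  shows "\<exists>C::real. 0 \<le> C \<and> (\<forall>(J :: 'j set) (J' :: 'k set) (\<alpha> :: 'j \<Rightarrow> real) (\<beta> :: 'k \<Rightarrow> real) (r :: nat).
       finite J \<longrightarrow> finite J' \<longrightarrow>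
       (\<forall>t. card {j\<in>J. \<alpha> j < t} \<le> card {j\<in>J'. \<beta> j < t} + r) \<longrightarrow>
       (\<forall>t. card {j\<in>J'. \<beta> j < t} \<le> card {j\<in>J. \<alpha> j < t} + r) \<longrightarrow>
       norm ((\<Sum>j\<in>J. \<phi> (\<alpha> j)) - (\<Sum>j\<in>J'. \<phi> (\<beta> j))) \<le> \<epsilon> * (card J + card J') + C * r)"
proof -
  obtain \<delta> where \<delta>: "0 < \<delta>" "\<And>x y. \<bar>x - y\<bar> < \<delta> \<Longrightarrow> norm (\<phi> x - \<phi> y) < \<epsilon>"
    using compact_support_uniformly_continuous[OF cont supp \<open>0 < \<epsilon>\<close>] by blast
  obtain B where B: "0 \<le> B" "\<And>x. norm (\<phi> x) \<le> B"
    using compact_support_bounded[OF cont supp] by blast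
  \<comment> \<open>Half of \<delta>, so that every point of a cell is strictly within \<delta> of
    its left end.\<close>
  define h where "h = \<delta> / 2"
  have h: "0 < h" "h < \<delta>" using \<delta>(1) by (auto simp: h_def)
  \<comment> \<open>Enough cells of width \<open>h\<close> to cover the interval from -|R| - 1 to
    |R| + 1; the absolute value covers a negative \<open>R\<close>.\<close>
  define m where "m = nat \<lceil>(2 * \<bar>R\<bar> + 2) / h\<rceil>"
  define grid where "grid k = - \<bar>R\<bar> - 1 + of_nat k * h" for k :: nat
  have grid_m: "\<bar>R\<bar> + 1 \<le> grid m"
  proof -
    have "(2 * \<bar>R\<bar> + 2) / h \<le> real m" unfolding m_def by (rule real_nat_ceiling_ge)
    then show ?thesis using h(1) by (simp add: grid_def field_simps)
  qed
  \<comment> \<open>The indicator of a cell, written as a difference of two threshold indicators so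
    that its sum is a difference of two counts.\<close>
  define ind where "ind k x = complex_of_real (of_bool (x < grid (Suc k)) - of_bool (x < grid k))" for k x
  define \<psi> where "\<psi> x = (\<Sum>k<m. \<phi> (grid k) * ind k x)" for x
  have ind: "ind k x = of_bool (\<lfloor>(x - grid 0) / h\<rfloor> = int k)" for k x
  proof -
    have "\<lfloor>(x - grid 0) / h\<rfloor> = int k \<longleftrightarrow> grid k \<le> x \<and> x < grid (Suc k)"
      using h(1) by (auto simp: floor_eq_iff grid_def field_simps)
    moreover have "grid k < grid (Suc k)" using h(1) by (simp add: grid_def field_simps)
    ultimately show ?thesis by (auto simp: ind_def)
  qed
  have approx: "norm (\<phi> x - \<psi> x) \<le> \<epsilon>" for x
  proof (cases "grid 0 \<le> x \<and> x < grid m")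
    case True
    define k where "k = nat \<lfloor>(x - grid 0) / h\<rfloor>"
    have k: "\<lfloor>(x - grid 0) / h\<rfloor> = int k" using True h(1) by (simp add: k_def)
    then have gk: "grid k \<le> x" "x < grid (Suc k)"
      using h(1) by (auto simp: floor_eq_iff grid_def field_simps)
    have "k < m"
    proof (rule ccontr)
      assume "\<not> k < m"
      then have "real m * h \<le> real k * h" using h(1) by simp
      then show False using gk True by (simp add: grid_def)
    qed
    have "\<psi> x = (\<Sum>k'<m. if k' = k then \<phi> (grid k) else 0)"
      unfolding \<psi>_def by (intro sum.cong refl) (auto simp: ind k)
    then have "\<psi> x = \<phi> (grid k)" using \<open>k < m\<close> by simp
    moreover have "\<bar>x - grid k\<bar> < \<delta>" using gk h by (simp add: grid_def algebra_simps)
    ultimately show ?thesis using \<delta>(2)[of x "grid k"] by simp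
  next
    case False
    then have "R < \<bar>x\<bar>" using grid_m by (auto simp: grid_def)
    moreover have "ind k x = 0" if "k < m" for k
    proof -
      have "real (Suc k) * h \<le> real m * h"
        using that h(1) by (intro mult_right_mono) auto
      moreover have "0 \<le> real k * h" using h(1) by simp
      ultimately have "grid (Suc k) \<le> grid m" "grid 0 \<le> grid k" "grid k \<le> grid (Suc k)"
        using h(1) by (auto simp: grid_def algebra_simps)
      then show ?thesis using False by (auto simp: ind_def)
    qed
    ultimately show ?thesis using supp[of x] \<open>0 < \<epsilon>\<close> by (simp add: \<psi>_def)
  qed
  have close: "norm ((\<Sum>j\<in>J. \<phi> (\<alpha> j)) - (\<Sum>j\<in>J. \<psi> (\<alpha> j))) \<le> \<epsilon> * card J" for J and \<alpha> :: "'z \<Rightarrow> real"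
  proof -
    have "norm (\<Sum>j\<in>J. \<phi> (\<alpha> j) - \<psi> (\<alpha> j)) \<le> (\<Sum>j\<in>J. \<epsilon>)"
      by (rule order.trans[OF norm_sum sum_mono]) (rule approx)
    then show ?thesis by (simp add: sum_subtractf mult.commute)
  qed
  have counts: "(\<Sum>j\<in>J. \<psi> (\<alpha> j)) = (\<Sum>k<m. \<phi> (grid k) *
       of_real (real (card {j\<in>J. \<alpha> j < grid (Suc k)}) - real (card {j\<in>J. \<alpha> j < grid k})))"
    if "finite J" for J and \<alpha> :: "'z \<Rightarrow> real"
  proof -
    have "(\<Sum>j\<in>J. \<psi> (\<alpha> j)) = (\<Sum>k<m. \<phi> (grid k) * (\<Sum>j\<in>J. ind k (\<alpha> j)))"
      unfolding \<psi>_def by (subst sum.swap) (simp add: sum_distrib_left)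
    moreover have "(\<Sum>j\<in>J. of_bool (\<alpha> j < t)) = real (card {j\<in>J. \<alpha> j < t})" for t
      using that by (simp add: of_bool_def sum.If_cases Int_def)
    ultimately show ?thesis by (simp add: ind_def sum_subtractf flip: of_real_sum)
  qed
  show ?thesis
  proof (intro exI[of _ "real m * (B * 2)"] conjI allI impI)
    show "0 \<le> real m * (B * 2)" using B by simp
    fix J :: "'j set" and J' :: "'k set" and \<alpha> :: "'j \<Rightarrow> real" and \<beta> :: "'k \<Rightarrow> real" and r :: nat
    assume fin: "finite J" "finite J'"
      and c1: "\<forall>t. card {j\<in>J. \<alpha> j < t} \<le> card {j\<in>J'. \<beta> j < t} + r"
      and c2: "\<forall>t. card {j\<in>J'. \<beta> j < t} \<le> card {j\<in>J. \<alpha> j < t} + r"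
    \<comment> \<open>The difference of the two counting functions. Each of the \<open>m\<close>
      cells involves it at two ends and thus contributes at most \<open>B * (2 * r)\<close>, which
      is the origin of the constant.\<close>
    define d where "d t = real (card {j\<in>J. \<alpha> j < t}) - real (card {j\<in>J'. \<beta> j < t})" for t
    have d: "\<bar>d t\<bar> \<le> r" for t using c1[rule_format, of t] c2[rule_format, of t] unfolding d_def by linarith
    have "(\<Sum>j\<in>J. \<psi> (\<alpha> j)) - (\<Sum>j\<in>J'. \<psi> (\<beta> j))
        = (\<Sum>k<m. \<phi> (grid k) * of_real (d (grid (Suc k)) - d (grid k)))"
      unfolding counts[OF fin(1)] counts[OF fin(2)] d_def
      by (simp add: sum_subtractf[symmetric] algebra_simps)
    also have "norm \<dots> \<le> (\<Sum>k<m. B * (2 * r))"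
    proof (rule order.trans[OF norm_sum sum_mono])
      fix k
      have "\<bar>d (grid (Suc k)) - d (grid k)\<bar> \<le> 2 * real r"
        using d[of "grid (Suc k)"] d[of "grid k"] by linarith
      then show "norm (\<phi> (grid k) * of_real (d (grid (Suc k)) - d (grid k))) \<le> B * (2 * r)"
        unfolding norm_mult norm_of_real using B by (intro mult_mono) auto
    qed
    finally have "norm ((\<Sum>j\<in>J. \<psi> (\<alpha> j)) - (\<Sum>j\<in>J'. \<psi> (\<beta> j))) \<le> real m * (B * 2) * r" by simp
    moreover note close[of \<alpha> J] close[of \<beta> J']
    moreover have "norm (a - b) \<le> e1 + e2 + e3"
      if "norm (a' - b') \<le> e3" "norm (a - a') \<le> e1" "norm (b - b') \<le> e2" for a b a' b' :: complex and e1 e2 e3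
      using that by norm
    ultimately show "norm ((\<Sum>j\<in>J. \<phi> (\<alpha> j)) - (\<Sum>j\<in>J'. \<phi> (\<beta> j)))
        \<le> \<epsilon> * (card J + card J') + real m * (B * 2) * r"
      unfolding of_nat_add distrib_left by blast
  qed
qed

section \<open>Perturbation of eigenvalue sums in the Frobenius norm\<close>

text \<open>The other half W^H W = 1 of unitarity, which turns the vectors of a
  \<open>spectral_family\<close> into eigenvectors.\<close>

definition orthonormal_on :: "'i set \<Rightarrow> 'j set \<Rightarrow> ('j \<Rightarrow> 'i \<Rightarrow> complex) \<Rightarrow> bool" where
  "orthonormal_on I J w \<longleftrightarrow> (\<forall>i\<in>J. \<forall>j\<in>J. (\<Sum>x\<in>I. cnj (w i x) * w j x) = of_bool (i = j))"

lemma spectral_family_left_eigenvector: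
  assumes A: "spectral_family I A J w \<alpha>" and "orthonormal_on I J w" and "i \<in> J" "y \<in> I"
  shows "(\<Sum>x\<in>I. cnj (w i x) * A x y) = complex_of_real (\<alpha> i) * cnj (w i y)"
proof -
  have fin: "finite J" using A by (simp add: spectral_family_def)
  have "(\<Sum>x\<in>I. cnj (w i x) * A x y)
      = (\<Sum>x\<in>I. \<Sum>j\<in>J. of_real (\<alpha> j) * cnj (w j y) * (cnj (w i x) * w j x))"
  proof (rule sum.cong[OF refl])
    fix x assume "x \<in> I"
    then have "A x y = (\<Sum>j\<in>J. of_real (\<alpha> j) * (w j x * cnj (w j y)))"
      using A \<open>y \<in> I\<close> by (simp add: spectral_family_def)
    then show "cnj (w i x) * A x y = (\<Sum>j\<in>J. of_real (\<alpha> j) * cnj (w j y) * (cnj (w i x) * w j x))"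
      by (simp add: sum_distrib_left algebra_simps)
  qed
  also have "\<dots> = (\<Sum>j\<in>J. of_real (\<alpha> j) * cnj (w j y) * (\<Sum>x\<in>I. cnj (w i x) * w j x))"
    by (subst sum.swap) (simp add: sum_distrib_left)
  also have "\<dots> = (\<Sum>j\<in>J. if i = j then of_real (\<alpha> j) * cnj (w j y) else 0)"
    using assms(2,3) by (intro sum.cong refl) (simp add: orthonormal_on_def)
  finally show ?thesis using fin \<open>i \<in> J\<close> by simp
qed

lemma spectral_family_right_eigenvector:
  assumes A: "spectral_family I A J w \<alpha>" and "orthonormal_on I J w" and "i \<in> J" "x \<in> I"
  shows "(\<Sum>y\<in>I. A x y * w i y) = complex_of_real (\<alpha> i) * w i x"
proof -
  \<comment> \<open>Hermitian symmetry is a consequence of the expansion, because the weights are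
    real.\<close>
  have herm: "A x y = cnj (A y x)" if "y \<in> I" for y
  proof -
    have "A x y = (\<Sum>j\<in>J. of_real (\<alpha> j) * (w j x * cnj (w j y)))"
      "A y x = (\<Sum>j\<in>J. of_real (\<alpha> j) * (w j y * cnj (w j x)))"
      using A \<open>x \<in> I\<close> that by (simp_all add: spectral_family_def)
    then show ?thesis by (simp add: mult.commute)
  qed
  have "(\<Sum>y\<in>I. A x y * w i y) = cnj (\<Sum>y\<in>I. cnj (w i y) * A y x)"
    by (simp add: herm mult.commute)
  then show ?thesis using spectral_family_left_eigenvector[OF assms] by simp
qed

text \<open>The identity behind the Hoffman--Wielandt inequality.\<close>

lemma spectral_family_distance:
  assumes A: "spectral_family I A J w \<alpha>" "orthonormal_on I J w"
    and B: "spectral_family I B J' u \<beta>" "orthonormal_on I J' u"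
  shows "(\<Sum>i\<in>J. \<Sum>j\<in>J'. (cmod (\<Sum>x\<in>I. cnj (w i x) * u j x))\<^sup>2 * (\<alpha> i - \<beta> j)\<^sup>2)
       = (\<Sum>x\<in>I. \<Sum>y\<in>I. (cmod (A x y - B x y))\<^sup>2)"
proof -
  \<comment> \<open>The matrix W^H (A - B). Its pairing with \<open>u j\<close> is the eigenvalue
    gap times the overlap of the two eigenvectors; Parseval in \<open>u\<close> and then in
    \<open>w\<close> turns the total into the squared Frobenius norm of A - B.\<close>
  define z where "z i y = (\<Sum>x\<in>I. cnj (w i x) * (A x y - B x y))" for i y
  have zu: "(\<Sum>y\<in>I. z i y * u j y) = of_real (\<alpha> i - \<beta> j) * (\<Sum>x\<in>I. cnj (w i x) * u j x)"
    if "i \<in> J" "j \<in> J'" for i j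
  proof -
    have "(\<Sum>y\<in>I. z i y * u j y) = (\<Sum>y\<in>I. (\<Sum>x\<in>I. cnj (w i x) * A x y) * u j y)
        - (\<Sum>y\<in>I. \<Sum>x\<in>I. cnj (w i x) * (B x y * u j y))"
      by (simp add: z_def algebra_simps sum_subtractf sum_distrib_left sum_distrib_right)
    also have "(\<Sum>y\<in>I. (\<Sum>x\<in>I. cnj (w i x) * A x y) * u j y)
        = (\<Sum>y\<in>I. of_real (\<alpha> i) * cnj (w i y) * u j y)"
      using spectral_family_left_eigenvector[OF A \<open>i \<in> J\<close>] by simp
    also have "(\<Sum>y\<in>I. \<Sum>x\<in>I. cnj (w i x) * (B x y * u j y))
        = (\<Sum>x\<in>I. cnj (w i x) * (\<Sum>y\<in>I. B x y * u j y))"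
      by (subst sum.swap) (simp add: sum_distrib_left)
    also have "\<dots> = (\<Sum>x\<in>I. cnj (w i x) * (of_real (\<beta> j) * u j x))"
      using spectral_family_right_eigenvector[OF B \<open>j \<in> J'\<close>] by simp
    finally show ?thesis by (simp add: algebra_simps sum_distrib_left sum_subtractf)
  qed
  have "(\<Sum>i\<in>J. \<Sum>j\<in>J'. (cmod (\<Sum>x\<in>I. cnj (w i x) * u j x))\<^sup>2 * (\<alpha> i - \<beta> j)\<^sup>2)
      = (\<Sum>i\<in>J. \<Sum>j\<in>J'. (cmod (\<Sum>y\<in>I. z i y * u j y))\<^sup>2)"
    by (intro sum.cong refl, subst zu) (simp_all add: norm_mult power_mult_distrib flip: of_real_diff)
  also have "\<dots> = (\<Sum>i\<in>J. \<Sum>y\<in>I. (cmod (z i y))\<^sup>2)"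
  proof (rule sum.cong[OF refl])
    fix i
    have "(\<Sum>y\<in>I. (cmod (cnj (z i y)))\<^sup>2) = (\<Sum>j\<in>J'. (cmod (\<Sum>y\<in>I. cnj (u j y) * cnj (z i y)))\<^sup>2)"
      by (rule norm_spectral_family[OF B(1)])
    also have "\<dots> = (\<Sum>j\<in>J'. (cmod (\<Sum>y\<in>I. z i y * u j y))\<^sup>2)"
    proof (rule sum.cong[OF refl])
      fix j
      have "(\<Sum>y\<in>I. cnj (u j y) * cnj (z i y)) = cnj (\<Sum>y\<in>I. z i y * u j y)" by (simp add: mult.commute)
      then show "(cmod (\<Sum>y\<in>I. cnj (u j y) * cnj (z i y)))\<^sup>2 = (cmod (\<Sum>y\<in>I. z i y * u j y))\<^sup>2"
        by (metis complex_mod_cnj)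
    qed
    finally show "(\<Sum>j\<in>J'. (cmod (\<Sum>y\<in>I. z i y * u j y))\<^sup>2) = (\<Sum>y\<in>I. (cmod (z i y))\<^sup>2)" by simp
  qed
  also have "\<dots> = (\<Sum>y\<in>I. \<Sum>i\<in>J. (cmod (z i y))\<^sup>2)" by (rule sum.swap)
  also have "\<dots> = (\<Sum>y\<in>I. \<Sum>x\<in>I. (cmod (A x y - B x y))\<^sup>2)"
    unfolding z_def by (simp only: norm_spectral_family[OF A(1), symmetric])
  also have "\<dots> = (\<Sum>x\<in>I. \<Sum>y\<in>I. (cmod (A x y - B x y))\<^sup>2)" by (rule sum.swap)
  finally show ?thesis .
qed

text \<open>The squared overlaps of two orthonormal eigenbases form a doubly stochastic matrix.
  Averaging both sums against it compares every pair of eigenvalues at once, so no ordering or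
  matching of the eigenvalues has to be found.\<close>

lemma spectral_sum_perturbation:
  fixes \<phi> :: "real \<Rightarrow> complex"
  assumes A: "spectral_family I A J w \<alpha>" "orthonormal_on I J w"
    and B: "spectral_family I B J' u \<beta>" "orthonormal_on I J' u"
    and \<phi>: "\<And>a b. norm (\<phi> a - \<phi> b) \<le> \<epsilon> + C * (a - b)\<^sup>2"
  shows "norm ((\<Sum>i\<in>J. \<phi> (\<alpha> i)) - (\<Sum>j\<in>J'. \<phi> (\<beta> j)))
       \<le> \<epsilon> * card I + C * (\<Sum>x\<in>I. \<Sum>y\<in>I. (cmod (A x y - B x y))\<^sup>2)"
proof -
  define P where "P i j = (cmod (\<Sum>x\<in>I. cnj (w i x) * u j x))\<^sup>2" for i j
  have cd: "card J = card I" using A by (simp add: spectral_family_def)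
  have unit: "(\<Sum>x\<in>I. (cmod (w' i x))\<^sup>2) = 1" if "orthonormal_on I K w'" "i \<in> K" for K :: "'k set" and w' i
  proof -
    have "complex_of_real (\<Sum>x\<in>I. (cmod (w' i x))\<^sup>2) = (\<Sum>x\<in>I. cnj (w' i x) * w' i x)"
      unfolding of_real_sum complex_norm_square by (simp only: mult.commute)
    also have "\<dots> = 1" using that by (simp add: orthonormal_on_def)
    finally show ?thesis by (metis of_real_eq_1_iff)
  qed
  have row: "(\<Sum>j\<in>J'. P i j) = 1" if "i \<in> J" for i
  proof -
    have "cmod (\<Sum>x\<in>I. cnj (w i x) * u j x) = cmod (\<Sum>x\<in>I. cnj (u j x) * w i x)" for j
    proof -
      have "(\<Sum>x\<in>I. cnj (w i x) * u j x) = cnj (\<Sum>x\<in>I. cnj (u j x) * w i x)" by (simp add: mult.commute)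
      then show ?thesis by (metis complex_mod_cnj)
    qed
    then show ?thesis
      using norm_spectral_family[OF B(1), of "w i"] unit[OF A(2) that] by (simp add: P_def)
  qed
  \<comment> \<open>Rows and columns sum to 1 by Parseval for a unit eigenvector of one matrix
    expanded in the eigenbasis of the other.\<close>
  have col: "(\<Sum>i\<in>J. P i j) = 1" if "j \<in> J'" for j
    using norm_spectral_family[OF A(1), of "u j"] unit[OF B(2) that] by (simp add: P_def)
  have "(\<Sum>i\<in>J. \<phi> (\<alpha> i)) = (\<Sum>i\<in>J. \<Sum>j\<in>J'. of_real (P i j) * \<phi> (\<alpha> i))"
    using row by (simp flip: sum_distrib_right of_real_sum)
  moreover have "(\<Sum>j\<in>J'. \<phi> (\<beta> j)) = (\<Sum>i\<in>J. \<Sum>j\<in>J'. of_real (P i j) * \<phi> (\<beta> j))"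
    using col by (subst sum.swap) (simp flip: sum_distrib_right of_real_sum)
  ultimately have "norm ((\<Sum>i\<in>J. \<phi> (\<alpha> i)) - (\<Sum>j\<in>J'. \<phi> (\<beta> j)))
      = norm (\<Sum>i\<in>J. \<Sum>j\<in>J'. of_real (P i j) * (\<phi> (\<alpha> i) - \<phi> (\<beta> j)))"
    by (simp add: sum_subtractf algebra_simps)
  also have "\<dots> \<le> (\<Sum>i\<in>J. \<Sum>j\<in>J'. P i j * (\<epsilon> + C * (\<alpha> i - \<beta> j)\<^sup>2))"
  proof (intro order.trans[OF norm_sum sum_mono])
    fix i j
    show "norm (of_real (P i j) * (\<phi> (\<alpha> i) - \<phi> (\<beta> j))) \<le> P i j * (\<epsilon> + C * (\<alpha> i - \<beta> j)\<^sup>2)"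
      using \<phi>[of "\<alpha> i" "\<beta> j"] unfolding norm_mult norm_of_real
      by (simp add: P_def mult_left_mono)
  qed
  also have "\<dots> = \<epsilon> * (\<Sum>i\<in>J. \<Sum>j\<in>J'. P i j) + C * (\<Sum>i\<in>J. \<Sum>j\<in>J'. P i j * (\<alpha> i - \<beta> j)\<^sup>2)"
    by (simp add: algebra_simps sum.distrib sum_distrib_left)
  also have "(\<Sum>i\<in>J. \<Sum>j\<in>J'. P i j) = card I" using row cd by simp
  finally show ?thesis unfolding P_def spectral_family_distance[OF A B] .
qed

section \<open>The spectral theorem for Hermitian matrices\<close>

lemma mat_adjoint_eq:
  assumes "A \<in> carrier_mat n m"
  shows "mat_adjoint A = Matrix.mat m n (\<lambda>(i, j). conjugate (A $$ (j, i)))"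
  using assms by (intro eq_matI) (auto simp: mat_adjoint_def mat_of_rows_index)

lemma mat_adjoint_carrier: "A \<in> carrier_mat n m \<Longrightarrow> mat_adjoint A \<in> carrier_mat m n"
  by (simp add: mat_adjoint_eq)

lemma mat_adjoint_mult:
  fixes A B :: "complex mat"
  assumes A: "A \<in> carrier_mat n m" and B: "B \<in> carrier_mat m l"
  shows "mat_adjoint (A * B) = mat_adjoint B * mat_adjoint A"
  using A B
  by (intro eq_matI) (auto simp: mat_adjoint_eq[OF A] mat_adjoint_eq[OF B] mat_adjoint_eq[OF mult_carrier_mat[OF A B]]
      scalar_prod_def mult.commute)

lemma mat_adjoint_mat_adjoint:
  fixes A :: "complex mat"
  assumes A: "A \<in> carrier_mat n m"
  shows "mat_adjoint (mat_adjoint A) = A"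
  unfolding mat_adjoint_eq[OF mat_adjoint_carrier[OF A]] unfolding mat_adjoint_eq[OF A]
  using A by (intro eq_matI) auto

text \<open>Gram-Schmidt applied to a basis starting with \<open>v\<close> keeps the first vector
  and gives orthogonal ones; dividing by the lengths \<open>r i\<close> makes them orthonormal, so
  the scalar \<open>c\<close> is the reciprocal of the length of \<open>v\<close>.\<close>

lemma unitary_completion:
  fixes v :: "complex vec"
  assumes v: "v \<in> carrier_vec n" "v \<noteq> 0\<^sub>v n"
  obtains W c where "W \<in> carrier_mat n n" "mat_adjoint W * W = 1\<^sub>m n" "col W 0 = c \<cdot>\<^sub>v v"
proof -
  interpret cof_vec_space n "TYPE(complex)" .
  define b where "b = basis_completion v"
  define ws where "ws = gram_schmidt n b"
  note bc = basis_completion[OF v, folded b_def]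
  have n: "0 < n" using v by (cases n) auto
  then obtain vs where bv: "b = v # vs" using bc(6,7) by (cases b) auto
  note gs = gram_schmidt_result[OF bc(2,4,5) ws_def]
  have len: "length ws = n" using gs(4) bc(6) by simp
  have ws: "ws ! i \<in> carrier_vec n" if "i < n" for i using gs(3) len that by auto
  have orth: "ws ! i \<bullet>c ws ! j = 0 \<longleftrightarrow> i \<noteq> j" if "i < n" "j < n" for i j
    using corthogonalD[OF gs(2)] len that by simp
  have hd: "ws ! 0 = v"
    using gram_schmidt_hd[OF v(1), of vs] len n unfolding ws_def bv by (metis hd_conv_nth length_0_conv less_irrefl)
  define r where "r i = sqrt (\<Sum>x<n. (cmod (ws ! i $ x))\<^sup>2)" for i
  have sp: "ws ! i \<bullet>c ws ! j = (\<Sum>x<n. ws ! i $ x * cnj (ws ! j $ x))" if "i < n" "j < n" for i j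
    using ws that by (auto simp: scalar_prod_def atLeast0LessThan intro!: sum.cong)
  have rr: "complex_of_real (r i * r i) = ws ! i \<bullet>c ws ! i" if "i < n" for i
    unfolding sp[OF that that] r_def by (simp add: sum_nonneg complex_norm_square flip: of_real_power)
  have r0: "r i \<noteq> 0" if "i < n" for i
  proof
    assume "r i = 0"
    then have "ws ! i \<bullet>c ws ! i = 0" using rr[OF that] by simp
    then show False using orth[OF that that] by simp
  qed
  define W where "W = Matrix.mat n n (\<lambda>(x, i). ws ! i $ x / of_real (r i))"
  have W: "W \<in> carrier_mat n n" by (simp add: W_def)
  have "mat_adjoint W * W = 1\<^sub>m n"
  proof (rule eq_matI)
    fix i j assume "i < dim_row (1\<^sub>m n :: complex mat)" "j < dim_col (1\<^sub>m n :: complex mat)"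
    then have ij: "i < n" "j < n" by auto
    have "(mat_adjoint W * W) $$ (i, j) = (\<Sum>x<n. mat_adjoint W $$ (i, x) * W $$ (x, j))"
      using ij W mat_adjoint_carrier[OF W] by (simp add: scalar_prod_def atLeast0LessThan)
    also have "\<dots> = (\<Sum>x<n. cnj (ws ! i $ x / of_real (r i)) * (ws ! j $ x / of_real (r j)))"
      unfolding mat_adjoint_eq[OF W] using ij by (intro sum.cong refl) (simp add: W_def)
    also have "\<dots> = (\<Sum>x<n. ws ! j $ x * cnj (ws ! i $ x)) / of_real (r i * r j)"
      by (simp add: sum_divide_distrib mult.commute)
    also have "\<dots> = (ws ! j \<bullet>c ws ! i) / of_real (r i * r j)" using sp ij by simp
    also have "\<dots> = of_bool (i = j)"
      using orth[of j i] rr[of i] r0[of i] ij by (cases "i = j") auto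
    finally show "(mat_adjoint W * W) $$ (i, j) = 1\<^sub>m n $$ (i, j)" using ij by simp
  qed (use W mat_adjoint_carrier[OF W] in auto)
  moreover have "col W 0 = (1 / of_real (r 0)) \<cdot>\<^sub>v v"
    using n v hd by (intro eq_vecI) (auto simp: W_def)
  ultimately show ?thesis using that W by blast
qed

lemma block_diag_mult:
  fixes A D :: "'a::semiring_1 mat"
  assumes "A \<in> carrier_mat k k" "D \<in> carrier_mat n n" "A' \<in> carrier_mat k k" "D' \<in> carrier_mat n n"
  shows "four_block_mat A (0\<^sub>m k n) (0\<^sub>m n k) D * four_block_mat A' (0\<^sub>m k n) (0\<^sub>m n k) D'
       = four_block_mat (A * A') (0\<^sub>m k n) (0\<^sub>m n k) (D * D')"
  unfolding mult_four_block_mat[OF assms(1) zero_carrier_mat[of k n] zero_carrier_mat[of n k] assms(2)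
      assms(3) zero_carrier_mat[of k n] zero_carrier_mat[of n k] assms(4)]
  using assms by simp

text \<open>Deflation: in an orthonormal basis that starts with an eigenvector, the first column of
  the matrix is a multiple of the first unit vector, and by symmetry so is the first row. The
  remaining block is again Hermitian.\<close>

lemma hermitian_unitary_diagonalization:
  fixes A :: "complex mat"
  assumes "A \<in> carrier_mat n n" "mat_adjoint A = A"
  shows "\<exists>U d. U \<in> carrier_mat n n \<and> mat_adjoint U * U = 1\<^sub>m n \<and>
           A * U = U * Matrix.mat n n (\<lambda>(i, j). if i = j then complex_of_real (d i) else 0)"
  using assms
proof (induction n arbitrary: A)
  case 0
  have "mat_adjoint (1\<^sub>m 0 :: complex mat) * 1\<^sub>m 0 = 1\<^sub>m 0"
    unfolding mat_adjoint_eq[OF one_carrier_mat] by (intro eq_matI) simp_all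
  moreover have "A * 1\<^sub>m 0 = 1\<^sub>m 0 * Matrix.mat 0 0 (\<lambda>(i, j). if i = j then complex_of_real 0 else 0)"
    using 0(1) by (intro eq_matI) simp_all
  ultimately show ?case by (intro exI[of _ "1\<^sub>m 0"] exI[of _ "\<lambda>_. 0"] conjI one_carrier_mat)
next
  case (Suc n)
  note A = Suc.prems(1)
  from char_poly_factorized[OF A] obtain as where as: "char_poly A = (\<Prod>a\<leftarrow>as. [:- a, 1:])" "length as = Suc n" by blast
  then obtain e es where "as = e # es" by (cases as) auto
  then have "poly (char_poly A) e = 0" using as by simp
  then have "eigenvalue A e" using eigenvalue_root_char_poly[OF A] by simp
  then obtain v where v: "v \<in> carrier_vec (Suc n)" "v \<noteq> 0\<^sub>v (Suc n)" "A *\<^sub>v v = e \<cdot>\<^sub>v v"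
    using A unfolding eigenvalue_def eigenvector_def by auto
  obtain W c where W: "W \<in> carrier_mat (Suc n) (Suc n)" "mat_adjoint W * W = 1\<^sub>m (Suc n)" "col W 0 = c \<cdot>\<^sub>v v"
    using unitary_completion[OF v(1,2)] by blast
  note Wa = mat_adjoint_carrier[OF W(1)]
  have WW: "W * mat_adjoint W = 1\<^sub>m (Suc n)" by (rule mat_mult_left_right_inverse[OF Wa W(1,2)])
  define B where "B = mat_adjoint W * (A * W)"
  have B: "B \<in> carrier_mat (Suc n) (Suc n)" unfolding B_def using A W(1) Wa by auto
  have Bh: "mat_adjoint B = B"
  proof -
    have "mat_adjoint B = (mat_adjoint W * A) * W"
      unfolding B_def mat_adjoint_mult[OF Wa mult_carrier_mat[OF A W(1)]] mat_adjoint_mult[OF A W(1)]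
        mat_adjoint_mat_adjoint[OF W(1)] Suc.prems(2) ..
    then show ?thesis unfolding B_def assoc_mult_mat[OF Wa A W(1)] .
  qed
  have Bh': "B $$ (i, j) = cnj (B $$ (j, i))" if "i < Suc n" "j < Suc n" for i j
    using arg_cong[OF Bh, of "\<lambda>M. M $$ (i, j)"] that by (simp add: mat_adjoint_eq[OF B])
  have "A *\<^sub>v col W 0 = e \<cdot>\<^sub>v col W 0"
    using v A unfolding W(3) by (simp add: mult_mat_vec[OF A v(1)] smult_smult_assoc mult.commute)
  then have "col (A * W) 0 = e \<cdot>\<^sub>v col W 0" using col_mult2[OF A W(1), of 0] by (metis zero_less_Suc)
  then have "col B 0 = mat_adjoint W *\<^sub>v (e \<cdot>\<^sub>v col W 0)"
    unfolding B_def using col_mult2[OF Wa mult_carrier_mat[OF A W(1)], of 0] by (metis zero_less_Suc)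
  also have "\<dots> = e \<cdot>\<^sub>v (mat_adjoint W *\<^sub>v col W 0)"
    by (intro mult_mat_vec[OF Wa] carrier_vecI) (simp add: carrier_matD[OF W(1)])
  also have "mat_adjoint W *\<^sub>v col W 0 = col (1\<^sub>m (Suc n)) 0"
    using col_mult2[OF Wa W(1), of 0] W(2) by simp
  finally have colB: "col B 0 = e \<cdot>\<^sub>v col (1\<^sub>m (Suc n)) 0" .
  have B0: "B $$ (i, 0) = (if i = 0 then e else 0)" if "i < Suc n" for i
    using arg_cong[OF colB, of "\<lambda>u. vec_index u i"] that B by auto
  \<comment> \<open>A diagonal entry of a Hermitian matrix is real, hence so is the
    eigenvalue.\<close>
  have cnj_e: "cnj e = e" using B0[of 0] Bh'[of 0 0, symmetric] by simp
  then have e: "complex_of_real (Re e) = e" by (simp add: Reals_cnj_iff)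
  have B0': "B $$ (0, i) = (if i = 0 then e else 0)" if "i < Suc n" for i
    unfolding Bh'[OF zero_less_Suc that] B0[OF that] using cnj_e by simp
  define A' where "A' = Matrix.mat n n (\<lambda>(i, j). B $$ (Suc i, Suc j))"
  have A': "A' \<in> carrier_mat n n" by (simp add: A'_def)
  have "mat_adjoint A' = A'"
    unfolding mat_adjoint_eq[OF A'] by (intro eq_matI) (auto simp: A'_def Bh'[symmetric])
  from Suc.IH[OF A' this] obtain U d where U: "U \<in> carrier_mat n n" "mat_adjoint U * U = 1\<^sub>m n"
    and AU: "A' * U = U * Matrix.mat n n (\<lambda>(i, j). if i = j then complex_of_real (d i) else 0)" by blast
  define D where "D = Matrix.mat n n (\<lambda>(i, j). if i = j then complex_of_real (d i) else 0)"
  have D: "D \<in> carrier_mat n n" by (simp add: D_def)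
  have AU': "A' * U = U * D" unfolding D_def by (rule AU)
  define d' where "d' = case_nat (Re e) d"
  define D' where "D' = Matrix.mat (Suc n) (Suc n) (\<lambda>(i, j). if i = j then complex_of_real (d' i) else 0)"
  have D': "D' \<in> carrier_mat (Suc n) (Suc n)" by (simp add: D'_def)
  define E where "E = Matrix.mat 1 1 (\<lambda>_. e)"
  \<comment> \<open>The diagonalization of the smaller block, extended by the identity on the
    eigenvector; the diagonalizing matrix of \<open>A\<close> is \<open>W * V\<close>.\<close>
  define V where "V = four_block_mat (1\<^sub>m 1) (0\<^sub>m 1 n) (0\<^sub>m n 1) U"
  note Ua = mat_adjoint_carrier[OF U(1)]
  have V: "V \<in> carrier_mat (Suc n) (Suc n)" unfolding V_def using four_block_carrier_mat[OF one_carrier_mat[of 1] U(1)] by simp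
  note Va = mat_adjoint_carrier[OF V]
  have Vadj: "mat_adjoint V = four_block_mat (1\<^sub>m 1) (0\<^sub>m 1 n) (0\<^sub>m n 1) (mat_adjoint U)"
    unfolding mat_adjoint_eq[OF V] unfolding mat_adjoint_eq[OF U(1)] V_def
    using U(1) by (intro eq_matI) auto
  have D'eq: "D' = four_block_mat E (0\<^sub>m 1 n) (0\<^sub>m n 1) D"
    unfolding D'_def D_def E_def d'_def using e by (intro eq_matI) (auto split: nat.split)
  have Beq: "B = four_block_mat E (0\<^sub>m 1 n) (0\<^sub>m n 1) A'"
    using B B0 B0' unfolding A'_def E_def by (intro eq_matI) auto
  have E: "E \<in> carrier_mat 1 1" by (simp add: E_def)

  have "B * V = V * D'"
    unfolding Beq V_def D'eq block_diag_mult[OF E A' one_carrier_mat U(1)] block_diag_mult[OF one_carrier_mat U(1) E D]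
      left_mult_one_mat[OF E] right_mult_one_mat[OF E] AU' ..
  moreover have VV: "mat_adjoint V * V = 1\<^sub>m (Suc n)"
    unfolding Vadj unfolding V_def block_diag_mult[OF one_carrier_mat Ua one_carrier_mat U(1)] U(2)
    by (simp add: left_mult_one_mat[OF one_carrier_mat])
  moreover have "A * (W * V) = W * (B * V)"
  proof -
    have "W * B = (W * mat_adjoint W) * (A * W)"
      unfolding B_def assoc_mult_mat[OF W(1) Wa mult_carrier_mat[OF A W(1)]] ..
    also have "\<dots> = A * W" unfolding WW by (rule left_mult_one_mat[OF mult_carrier_mat[OF A W(1)]])
    finally have "A * W * V = W * B * V" by simp
    then show ?thesis unfolding assoc_mult_mat[OF A W(1) V] assoc_mult_mat[OF W(1) B V] .
  qed
  moreover have "mat_adjoint (W * V) * (W * V) = 1\<^sub>m (Suc n)"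
  proof -
    have "mat_adjoint (W * V) * (W * V) = mat_adjoint V * ((mat_adjoint W * W) * V)"
      unfolding mat_adjoint_mult[OF W(1) V] assoc_mult_mat[OF Va Wa mult_carrier_mat[OF W(1) V]]
        assoc_mult_mat[OF Wa W(1) V] ..
    then show ?thesis unfolding W(2) left_mult_one_mat[OF V] VV .
  qed
  moreover have "W * (V * D') = (W * V) * D'"
    by (rule assoc_mult_mat[OF W(1) V D', symmetric])
  ultimately have "A * (W * V) = (W * V) * D'" "mat_adjoint (W * V) * (W * V) = 1\<^sub>m (Suc n)" by simp_all
  then show ?case
    using mult_carrier_mat[OF W(1) V] unfolding D'_def by blast
qed

lemma proots_prod_list_linear: "proots (\<Prod>a\<leftarrow>as. [:- a, 1 :: complex:]) = mset as"
proof (induction as)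
  case (Cons a as)
  have "(\<Prod>a\<leftarrow>as. [:- a, 1 :: complex:]) \<noteq> 0" by (auto simp: prod_list_zero_iff)
  then show ?case using Cons by (simp add: proots_mult del: mult_pCons_left)
qed simp

lemma index_mult_mat_sum:
  assumes "A \<in> carrier_mat n m" "B \<in> carrier_mat m l" "i < n" "j < l"
  shows "(A * B) $$ (i, j) = (\<Sum>k<m. A $$ (i, k) * B $$ (k, j))"
  using assms by (simp add: scalar_prod_def atLeast0LessThan)

text \<open>Besides both forms of unitarity it identifies the weights with the roots of the
  characteristic polynomial, with multiplicity. This is the bridge between the function-based
  expansions and \<open>eigenvalue_distributed\<close>.\<close>

theorem hermitian_spectral_family:
  fixes A :: "complex mat"
  assumes A: "A \<in> carrier_mat n n" and herm: "mat_adjoint A = A"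
  obtains w \<alpha> where "spectral_family {..<n} (\<lambda>x y. A $$ (x, y)) {..<n} w \<alpha>"
    "orthonormal_on {..<n} {..<n} w"
    "eigenvalue_mset A = image_mset (\<lambda>j. complex_of_real (\<alpha> j)) (mset_set {..<n})"
proof -
  obtain U d where U: "U \<in> carrier_mat n n" "mat_adjoint U * U = 1\<^sub>m n"
    and AU: "A * U = U * Matrix.mat n n (\<lambda>(i, j). if i = j then complex_of_real (d i) else 0)"
    using hermitian_unitary_diagonalization[OF A herm] by blast
  define D where "D = Matrix.mat n n (\<lambda>(i, j). if i = j then complex_of_real (d i) else 0)"
  have D: "D \<in> carrier_mat n n" by (simp add: D_def)
  note Ua = mat_adjoint_carrier[OF U(1)]
  have UU: "U * mat_adjoint U = 1\<^sub>m n" by (rule mat_mult_left_right_inverse[OF Ua U])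
  have "A = A * (U * mat_adjoint U)" unfolding UU using A by simp
  also have "\<dots> = U * D * mat_adjoint U"
    unfolding assoc_mult_mat[OF A U(1) Ua, symmetric] AU[folded D_def] ..
  finally have AD: "A = U * D * mat_adjoint U" .
  define w where "w j x = U $$ (x, j)" for j x
  have ad: "mat_adjoint U $$ (i, j) = cnj (w i j)" if "i < n" "j < n" for i j
    using that by (simp add: mat_adjoint_eq[OF U(1)] w_def)
  have "spectral_family {..<n} (\<lambda>x y. A $$ (x, y)) {..<n} w d"
    unfolding spectral_family_def
  proof (intro conjI ballI)
    fix x y assume "x \<in> {..<n}" "y \<in> {..<n}"
    then have xy: "x < n" "y < n" by auto
    have "(\<Sum>j<n. w j x * cnj (w j y)) = (U * mat_adjoint U) $$ (x, y)"
      unfolding index_mult_mat_sum[OF U(1) Ua xy] using xy by (intro sum.cong refl) (simp add: ad w_def)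
    then show "(\<Sum>j<n. w j x * cnj (w j y)) = of_bool (x = y)" using xy by (simp add: UU)
    have UD: "(U * D) $$ (x, j) = w j x * of_real (d j)" if "j < n" for j
    proof -
      have "(U * D) $$ (x, j) = (\<Sum>k<n. if k = j then w j x * of_real (d j) else 0)"
        unfolding index_mult_mat_sum[OF U(1) D xy(1) that]
        using xy that by (intro sum.cong refl) (simp add: w_def D_def)
      then show ?thesis using that by simp
    qed
    have "A $$ (x, y) = (\<Sum>j<n. (U * D) $$ (x, j) * mat_adjoint U $$ (j, y))"
      unfolding AD by (rule index_mult_mat_sum[OF mult_carrier_mat[OF U(1) D] Ua xy])
    also have "\<dots> = (\<Sum>j<n. of_real (d j) * (w j x * cnj (w j y)))"
      using xy by (intro sum.cong refl) (simp add: UD ad)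
    finally show "(\<Sum>j<n. of_real (d j) * (w j x * cnj (w j y))) = A $$ (x, y)" by simp
  qed auto
  moreover have "orthonormal_on {..<n} {..<n} w"
    unfolding orthonormal_on_def
  proof (intro ballI)
    fix i j assume "i \<in> {..<n}" "j \<in> {..<n}"
    then have ij: "i < n" "j < n" by auto
    have "(\<Sum>x<n. cnj (w i x) * w j x) = (mat_adjoint U * U) $$ (i, j)"
      unfolding index_mult_mat_sum[OF Ua U(1) ij] using ij by (intro sum.cong refl) (simp add: ad w_def)
    then show "(\<Sum>x<n. cnj (w i x) * w j x) = of_bool (i = j)" using ij by (simp add: U(2))
  qed
  moreover have "eigenvalue_mset A = image_mset (\<lambda>j. complex_of_real (d j)) (mset_set {..<n})"
  proof -
    have "similar_mat_wit A D U (mat_adjoint U)"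
      unfolding similar_mat_wit_def Let_def using A U Ua D UU AD by auto
    then have "char_poly A = char_poly D" by (intro char_poly_similar) (auto simp: similar_mat_def)
    also have "\<dots> = (\<Prod>a\<leftarrow>diag_mat D. [:- a, 1:])"
      by (rule char_poly_upper_triangular[OF D]) (auto simp: D_def)
    finally have "eigenvalue_mset A = mset (diag_mat D)"
      by (simp add: eigenvalue_mset_def proots_prod_list_linear)
    also have "diag_mat D = map (\<lambda>j. complex_of_real (d j)) [0..<n]"
      by (auto simp: diag_mat_def D_def)
    finally show ?thesis by (simp add: atLeast0LessThan)
  qed
  ultimately show ?thesis using that by blast
qed

section \<open>Riemann sums\<close>

lemma symbol_domain_eq_box: "symbol_domain = box (- pi, - pi) (pi, pi)"
proof -
  have "box (- pi, - pi) (pi, pi) = interior (cbox (- pi, - pi) (pi, pi))" by (simp only: interior_cbox)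
  also have "\<dots> = {- pi<..<pi} \<times> {- pi<..<pi}" by (simp add: cbox_Pair_eq interior_Times)
  finally show ?thesis by (simp add: symbol_domain_def)
qed

lemma symbol_domain_lmeasurable: "symbol_domain \<in> lmeasurable"
  unfolding symbol_domain_eq_box by (rule lmeasurable_box)

lemma measure_symbol_domain: "measure lebesgue symbol_domain = (2 * pi)\<^sup>2"
proof -
  have "measure lebesgue symbol_domain = measure lborel (box (- pi, - pi) (pi, pi))"
    unfolding symbol_domain_eq_box by (rule measure_completion) simp
  also have "\<dots> = measure lborel (cbox (- pi, - pi) (pi, pi))"
    by (simp only: measure_lborel_box_eq measure_lborel_cbox_eq)
  also have "\<dots> = (2 * pi)\<^sup>2" unfolding content_Pair by (simp add: power2_eq_square)
  finally show ?thesis .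
qed

text \<open>The boundary of the square is negligible and the integrand continuous, so the integral
  may be iterated over closed intervals, where one-dimensional Riemann sums apply.\<close>

lemma lebesgue_integral_symbol_domain:
  fixes h :: "real \<times> real \<Rightarrow> complex"
  assumes "continuous_on UNIV h"
  shows "(LINT \<theta>|lebesgue_on symbol_domain. h \<theta>)
       = integral {- pi..pi} (\<lambda>x. integral {- pi..pi} (\<lambda>y. h (x, y)))"
proof -
  have c: "continuous_on (cbox (- pi, - pi) (pi, pi)) h" by (rule continuous_on_subset[OF assms]) simp
  have "set_integrable lebesgue (box (- pi, - pi) (pi, pi)) h"
    by (rule set_integrable_subset[OF absolutely_integrable_continuous[OF c]]) (auto simp: box_subset_cbox)
  then have "integrable (lebesgue_on symbol_domain) h"
    unfolding symbol_domain_eq_box set_integrable_def by (simp add: integrable_restrict_space)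
  then have "(LINT \<theta>|lebesgue_on symbol_domain. h \<theta>) = integral symbol_domain h"
    by (rule lebesgue_integral_eq_integral) (use symbol_domain_lmeasurable in auto)
  also have "\<dots> = integral (cbox (- pi, - pi) (pi, pi)) h"
    unfolding symbol_domain_eq_box by (rule integral_open_interval)
  also have "\<dots> = integral (cbox (- pi) pi) (\<lambda>x. integral (cbox (- pi) pi) (\<lambda>y. h (x, y)))"
    by (rule integral_prod_continuous[OF c])
  finally show ?thesis by simp
qed

text \<open>The oscillation over one mesh width is a hypothesis, so that the estimate can be used
  with one tolerance for slices of a function of two variables and with another for the integrals of
  the slices.\<close>

lemma riemann_sum_error:
  fixes g :: "real \<Rightarrow> complex"
  assumes "a < b" and cont: "continuous_on {a..b} g" and "0 < n"
    and osc: "\<And>x y. x \<in> {a..b} \<Longrightarrow> y \<in> {a..b} \<Longrightarrow> \<bar>x - y\<bar> \<le> (b - a) / real n \<Longrightarrow> norm (g x - g y) \<le> \<epsilon>"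
  shows "norm (integral {a..b} g - of_real ((b - a) / real n) * (\<Sum>m<n. g (a + (b - a) * real m / real n)))
       \<le> \<epsilon> * (b - a)"
proof -
  define h where "h = (b - a) / real n"
  define t where "t m = a + h * real m" for m :: nat
  have h: "0 < h" using assms by (simp add: h_def)
  have tn: "t n = b" "t 0 = a" using \<open>0 < n\<close> by (auto simp: t_def h_def)
  have tmono: "t i \<le> t j" if "i \<le> j" for i j using that h by (simp add: t_def)
  have tS: "t (Suc m) = t m + h" for m by (simp add: t_def algebra_simps)
  have cont': "continuous_on {t i..t j} g" if "j \<le> n" for i j
  proof (rule continuous_on_subset[OF cont])
    show "{t i..t j} \<subseteq> {a..b}" using tmono[of 0 i] tmono[of j n] that tn by auto
  qed
  have "integral {a..t k} g = (\<Sum>m<k. integral {t m..t (Suc m)} g)" if "k \<le> n" for k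
    using that
  proof (induction k)
    case (Suc k)
    have "integral {a..t k} g + integral {t k..t (Suc k)} g = integral {a..t (Suc k)} g"
      using Suc.prems tmono[of 0 k] tn cont'[of "Suc k" 0] tmono[of k "Suc k"]
      by (intro Henstock_Kurzweil_Integration.integral_combine integrable_continuous_real) auto
    then show ?case using Suc by simp
  qed (simp add: tn)
  from this[of n] have split: "integral {a..b} g = (\<Sum>m<n. integral {t m..t (Suc m)} g)" using tn by simp
  have cell: "norm (integral {t m..t (Suc m)} g - of_real h * g (t m)) \<le> \<epsilon> * h" if "m < n" for m
  proof -
    have c: "continuous_on {t m..t (Suc m)} g" using that by (intro cont') simp
    have le: "t m \<le> t (Suc m)" by (rule tmono) simp
    have "integral {t m..t (Suc m)} (\<lambda>x. g (t m)) = of_real h * g (t m)"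
      using le by (simp add: tS scaleR_conv_of_real)
    then have "integral {t m..t (Suc m)} g - of_real h * g (t m) = integral {t m..t (Suc m)} (\<lambda>x. g x - g (t m))"
      using c by (subst Henstock_Kurzweil_Integration.integral_diff) (auto intro: integrable_continuous_real)
    also have "norm \<dots> \<le> \<epsilon> * (t (Suc m) - t m)"
    proof (rule Henstock_Kurzweil_Integration.integral_bound[OF le])
      show "continuous_on {t m..t (Suc m)} (\<lambda>x. g x - g (t m))" by (intro continuous_intros c)
      fix x assume x: "x \<in> {t m..t (Suc m)}"
      have "a \<le> t m" "t (Suc m) \<le> b" using tmono[of 0 m] tmono[of "Suc m" n] that tn by auto
      then show "norm (g x - g (t m)) \<le> \<epsilon>"
        using x h le by (intro osc) (auto simp: tS h_def[symmetric])
    qed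
    finally show ?thesis by (simp add: tS)
  qed
  have "integral {a..b} g - of_real h * (\<Sum>m<n. g (t m))
      = (\<Sum>m<n. integral {t m..t (Suc m)} g - of_real h * g (t m))"
    unfolding split by (simp add: sum_subtractf sum_distrib_left)
  also have "norm \<dots> \<le> (\<Sum>m<n. \<epsilon> * h)" by (intro order.trans[OF norm_sum sum_mono] cell) simp
  also have "\<dots> = \<epsilon> * (b - a)" using \<open>0 < n\<close> by (simp add: h_def)
  finally show ?thesis by (simp add: t_def h_def)
qed

text \<open>Left ends of a uniform partition of the period. The same points serve as Riemann nodes
  and as frequencies of the comparison matrix. The first one, -pi, lies outside
  \<open>symbol_domain\<close>, but the symbol is defined there as well.\<close>

definition grid_point :: "nat \<Rightarrow> nat \<Rightarrow> real" where
  "grid_point n m = - pi + 2 * pi * real m / real n"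

lemma eventually_min_at_top: "(\<forall>\<^sub>F n in min_at_top. P n) \<longleftrightarrow> (\<exists>m. \<forall>n1\<ge>m. \<forall>n2\<ge>m. P (n1, n2))"
proof
  assume "\<forall>\<^sub>F n in min_at_top. P n"
  then obtain Q where Q: "eventually Q at_top" "\<And>n1 n2. Q (min n1 n2) \<Longrightarrow> P (n1, n2)"
    unfolding min_at_top_def eventually_filtercomap by auto
  then obtain m where "\<And>k. k \<ge> m \<Longrightarrow> Q k" unfolding eventually_at_top_linorder by blast
  then show "\<exists>m. \<forall>n1\<ge>m. \<forall>n2\<ge>m. P (n1, n2)" using Q(2) by (intro exI[of _ m]) auto
next
  assume "\<exists>m. \<forall>n1\<ge>m. \<forall>n2\<ge>m. P (n1, n2)"
  then obtain m where m: "\<And>n1 n2. m \<le> n1 \<Longrightarrow> m \<le> n2 \<Longrightarrow> P (n1, n2)" by blast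
  show "\<forall>\<^sub>F n in min_at_top. P n"
    unfolding min_at_top_def eventually_filtercomap
  proof (intro exI[of _ "\<lambda>k. m \<le> k"] conjI allI impI)
    show "eventually (\<lambda>k. m \<le> k) at_top" by (rule eventually_ge_at_top)
    fix x :: "nat \<times> nat" assume "m \<le> (case x of (n1, n2) \<Rightarrow> min n1 n2)"
    then show "P x" using m by (cases x) auto
  qed
qed

lemma grid_average_tendsto:
  fixes h :: "real \<times> real \<Rightarrow> complex"
  assumes cont: "continuous_on UNIV h"
  shows "((\<lambda>(n1, n2). (\<Sum>m1<n1. \<Sum>m2<n2. h (grid_point n1 m1, grid_point n2 m2)) / of_nat (n1 * n2))
    \<longlongrightarrow> (LINT \<theta>|lebesgue_on symbol_domain. h \<theta>) / complex_of_real (measure lebesgue symbol_domain)) min_at_top"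
proof (rule tendstoI)
  fix e :: real assume "0 < e"
  define I where "I x = integral {- pi..pi} (\<lambda>y. h (x, y))" for x
  \<comment> \<open>The inner and the outer Riemann sum each cost \<epsilon> after division by the
    area; a third of \<open>e\<close> leaves the final inequality strict.\<close>
  define \<epsilon> where "\<epsilon> = e / 3"
  have "0 < \<epsilon>" using \<open>0 < e\<close> by (simp add: \<epsilon>_def)
  have "uniformly_continuous_on (cbox (- pi, - pi) (pi, pi)) h"
    by (intro compact_uniformly_continuous continuous_on_subset[OF cont]) auto
  then obtain \<delta> where \<delta>: "0 < \<delta>"
    "\<And>x y. x \<in> cbox (- pi, - pi) (pi, pi) \<Longrightarrow> y \<in> cbox (- pi, - pi) (pi, pi) \<Longrightarrow> dist y x < \<delta> \<Longrightarrow> dist (h y) (h x) < \<epsilon>"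
    using \<open>0 < \<epsilon>\<close> unfolding uniformly_continuous_on_def by metis
  have hx: "continuous_on UNIV (\<lambda>y. h (x, y))" for x
    by (intro continuous_on_compose2[OF cont] continuous_intros) auto

  have oscx: "norm (h (x, y) - h (x', y)) \<le> \<epsilon>" if "x \<in> {- pi..pi}" "x' \<in> {- pi..pi}" "y \<in> {- pi..pi}" "\<bar>x - x'\<bar> < \<delta>" for x x' y
    using \<delta>(2)[of "(x', y)" "(x, y)"] that by (simp add: cbox_Pair_eq dist_Pair_Pair dist_norm)
  have oscy: "norm (h (x, y) - h (x, y')) \<le> \<epsilon>" if "x \<in> {- pi..pi}" "y \<in> {- pi..pi}" "y' \<in> {- pi..pi}" "\<bar>y - y'\<bar> < \<delta>" for x y y'
    using \<delta>(2)[of "(x, y')" "(x, y)"] that by (simp add: cbox_Pair_eq dist_Pair_Pair dist_norm)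
  have contI: "continuous_on {- pi..pi} I"
  proof -
    have "continuous_on ({- pi..pi} \<times> cbox (- pi) pi) (\<lambda>(x, t). h (x, t))"
      by (simp add: continuous_on_subset[OF cont])
    from integral_continuous_on_param[OF this] show ?thesis by (simp add: I_def)
  qed
  \<comment> \<open>Integrating over a slice of length 2 pi multiplies the oscillation by that
    length.\<close>
  have oscI: "norm (I x - I x') \<le> \<epsilon> * (2 * pi)" if "x \<in> {- pi..pi}" "x' \<in> {- pi..pi}" "\<bar>x - x'\<bar> < \<delta>" for x x'
  proof -
    have "I x - I x' = integral {- pi..pi} (\<lambda>y. h (x, y) - h (x', y))"
      unfolding I_def
      by (rule Henstock_Kurzweil_Integration.integral_diff[symmetric])
        (intro integrable_continuous_real continuous_on_subset[OF hx] subset_UNIV)+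
    also have "norm \<dots> \<le> \<epsilon> * (pi - - pi)"
      by (intro Henstock_Kurzweil_Integration.integral_bound continuous_intros continuous_on_subset[OF hx])
        (auto intro!: oscx that)
    finally show ?thesis by simp
  qed
  obtain m where m: "2 * pi / \<delta> < real m" using reals_Archimedean2 by blast
  show "\<forall>\<^sub>F n in min_at_top. dist (case n of (n1, n2) \<Rightarrow>
      (\<Sum>m1<n1. \<Sum>m2<n2. h (grid_point n1 m1, grid_point n2 m2)) / of_nat (n1 * n2))
      ((LINT \<theta>|lebesgue_on symbol_domain. h \<theta>) / complex_of_real (measure lebesgue symbol_domain)) < e"
    unfolding eventually_min_at_top
  proof (intro exI[of _ "Suc m"] allI impI)
    fix n1 n2 assume n: "Suc m \<le> n1" "Suc m \<le> n2"
    have small: "(pi - - pi) / real k < \<delta>" if "Suc m \<le> k" for k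
    proof -
      have "2 * pi / \<delta> < real k" using m that by linarith
      then show ?thesis using \<delta>(1) that by (simp add: field_simps)
    qed
    have pos: "0 < n1" "0 < n2" using n by auto
    define S where "S x = (\<Sum>m2<n2. h (x, grid_point n2 m2))" for x
    have gp: "- pi + (pi - - pi) * real j / real k = grid_point k j" for k j by (simp add: grid_point_def)
    have gp_in: "grid_point k j \<in> {- pi..pi}" if "j < k" for k j
    proof -
      have "2 * pi * real j \<le> 2 * pi * real k" using that by simp
      then show ?thesis using that by (simp add: grid_point_def field_simps)
    qed
    have err1: "norm (integral {- pi..pi} I - of_real ((pi - - pi) / real n1) * (\<Sum>m1<n1. I (grid_point n1 m1)))
        \<le> (\<epsilon> * (2 * pi)) * (pi - - pi)"
      unfolding gp[symmetric]
      by (rule riemann_sum_error[OF _ contI pos(1)]) (use small[OF n(1)] oscI in force)+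
    have err2: "norm (I x - of_real ((pi - - pi) / real n2) * S x) \<le> \<epsilon> * (pi - - pi)" if "x \<in> {- pi..pi}" for x
      unfolding I_def S_def gp[symmetric]
      by (rule riemann_sum_error[OF _ continuous_on_subset[OF hx] pos(2)]) (use small[OF n(2)] oscy that in force)+
    have "norm ((\<Sum>m1<n1. I (grid_point n1 m1)) - of_real (2 * pi / real n2) * (\<Sum>m1<n1. S (grid_point n1 m1)))
        = norm (\<Sum>m1<n1. I (grid_point n1 m1) - of_real (2 * pi / real n2) * S (grid_point n1 m1))"
      by (simp add: sum_subtractf sum_distrib_left)
    also have "\<dots> \<le> (\<Sum>m1<n1. \<epsilon> * (2 * pi))"
      by (intro order.trans[OF norm_sum sum_mono]) (use err2 gp_in in force)
    finally have err3: "norm ((\<Sum>m1<n1. I (grid_point n1 m1)) - of_real (2 * pi / real n2) * (\<Sum>m1<n1. S (grid_point n1 m1)))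
        \<le> real n1 * (\<epsilon> * (2 * pi))" by simp
    define T where "T = (\<Sum>m1<n1. S (grid_point n1 m1))"
    have "norm (of_real (2 * pi / real n1) * (\<Sum>m1<n1. I (grid_point n1 m1)) - of_real ((2 * pi)\<^sup>2 / (real n1 * real n2)) * T)
        = norm (complex_of_real (2 * pi / real n1)) *
          norm ((\<Sum>m1<n1. I (grid_point n1 m1)) - of_real (2 * pi / real n2) * T)"
      unfolding norm_mult[symmetric] by (simp add: algebra_simps power2_eq_square)
    also have "\<dots> \<le> (2 * pi / real n1) * (real n1 * (\<epsilon> * (2 * pi)))"
      unfolding norm_of_real using err3 by (intro mult_mono) (auto simp: T_def)
    also have "\<dots> = \<epsilon> * (2 * pi)\<^sup>2" using pos by (simp add: power2_eq_square)
    finally have "norm (integral {- pi..pi} I - of_real ((2 * pi)\<^sup>2 / (real n1 * real n2)) * T)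
        \<le> \<epsilon> * (2 * pi)\<^sup>2 + \<epsilon> * (2 * pi)\<^sup>2"
      using err1 norm_triangle_le[of "integral {- pi..pi} I - of_real (2 * pi / real n1) * (\<Sum>m1<n1. I (grid_point n1 m1))"
        "of_real (2 * pi / real n1) * (\<Sum>m1<n1. I (grid_point n1 m1)) - of_real ((2 * pi)\<^sup>2 / (real n1 * real n2)) * T"]
      by (simp add: power2_eq_square algebra_simps)
    moreover have "integral {- pi..pi} I - of_real ((2 * pi)\<^sup>2 / (real n1 * real n2)) * T
        = of_real ((2 * pi)\<^sup>2) * (integral {- pi..pi} I / of_real ((2 * pi)\<^sup>2) - T / of_nat (n1 * n2))"
      by (simp add: field_simps)
    ultimately have "(2 * pi)\<^sup>2 * norm (integral {- pi..pi} I / of_real ((2 * pi)\<^sup>2) - T / of_nat (n1 * n2)) \<le> (2 * pi)\<^sup>2 * (2 * \<epsilon>)"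
      by (simp only: norm_mult norm_of_real abs_power2 abs_of_nonneg) (simp add: algebra_simps)
    then have "norm (integral {- pi..pi} I / of_real ((2 * pi)\<^sup>2) - T / of_nat (n1 * n2)) \<le> 2 * \<epsilon>"
      by simp
    also have "\<dots> < e" using \<open>0 < e\<close> by (simp add: \<epsilon>_def)
    finally show "dist (case (n1, n2) of (n1, n2) \<Rightarrow>
        (\<Sum>m1<n1. \<Sum>m2<n2. h (grid_point n1 m1, grid_point n2 m2)) / of_nat (n1 * n2))
        ((LINT \<theta>|lebesgue_on symbol_domain. h \<theta>) / complex_of_real (measure lebesgue symbol_domain)) < e"
      unfolding lebesgue_integral_symbol_domain[OF cont] measure_symbol_domain
      by (simp only: dist_norm prod.case norm_minus_commute I_def[symmetric] T_def S_def)
  qed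
qed

section \<open>The matrices of the discretization\<close>

text \<open>The case \<open>p = 0\<close> is included: the only node is 0 / 0 = 0 and the product is
  empty.\<close>

lemma lagrange_basis_node:
  assumes "j \<le> p" "k \<le> p"
  shows "lagrange_basis p k (real j / real p) = of_bool (j = k)"
proof (cases "j = k")
  case True
  have "(real k / real p - real i / real p) / (real k / real p - real i / real p) = 1" if "i \<in> {..p} - {k}" for i
  proof -
    have "i \<noteq> k" "0 < p" using that assms by auto
    then have "real k / real p - real i / real p \<noteq> 0" by simp
    then show ?thesis by simp
  qed
  then show ?thesis unfolding lagrange_basis_def True by (simp only: prod.neutral_const prod.cong) simp
next
  case False
  then show ?thesis
    unfolding lagrange_basis_def using assms by (auto intro!: prod_zero bexI[of _ j])
qed

lemma continuous_on_lagrange_basis: "continuous_on S (lagrange_basis p k)"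
proof -
  have "lagrange_basis p k = (\<lambda>\<xi>. \<Prod>j\<in>{..p} - {k}. (\<xi> - real j / real p) * inverse (real k / real p - real j / real p))"
    by (simp add: fun_eq_iff lagrange_basis_def divide_inverse)
  then show ?thesis by (simp only:) (intro continuous_intros)
qed

lemma M_mat_carrier: "M_mat p \<in> carrier_mat (p + 1) (p + 1)"
  by (simp add: M_mat_def)

lemma transpose_M_mat: "transpose_mat (M_mat p) = M_mat p"
  by (intro eq_matI) (auto simp: M_mat_def mult.commute)

text \<open>A Gram matrix argument: for \<open>v\<close> in the kernel, the quadratic form of
  \<open>v\<close> is the integral of the square of the interpolating function \<open>g\<close>. So
  \<open>g\<close> vanishes on the unit interval, and its values at the nodes are the entries of
  \<open>v\<close>.\<close>

lemma det_M_mat: "det (M_mat p) \<noteq> 0"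
proof
  assume "det (M_mat p) = 0"
  then obtain v where v: "v \<in> carrier_vec (p + 1)" "v \<noteq> 0\<^sub>v (p + 1)" "M_mat p *\<^sub>v v = 0\<^sub>v (p + 1)"
    using det_0_iff_vec_prod_zero_field[OF M_mat_carrier] by blast
  define n where "n = p + 1"
  have carr: "M_mat p \<in> carrier_mat n n" "v \<in> carrier_vec n" "M_mat p *\<^sub>v v = 0\<^sub>v n"
    using v M_mat_carrier[of p] by (simp_all add: n_def)
  define g where "g \<xi> = (\<Sum>k<n. vec_index v k * lagrange_basis p k \<xi>)" for \<xi>
  have contg: "continuous_on S g" for S
    unfolding g_def by (intro continuous_intros continuous_on_lagrange_basis)
  have Mv: "(\<Sum>l<n. M_mat p $$ (k, l) * vec_index v l) = 0" if "k < n" for k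
  proof -
    have "vec_index (M_mat p *\<^sub>v v) k = (\<Sum>l<n. M_mat p $$ (k, l) * vec_index v l)"
      using that carr(1,2) by (simp add: scalar_prod_def atLeast0LessThan)
    then show ?thesis using that by (simp add: carr(3))
  qed
  have int: "(\<lambda>\<xi>. c * (lagrange_basis p k \<xi> * lagrange_basis p l \<xi>)) integrable_on {0..1}" for c k l
    by (intro integrable_continuous_real continuous_intros continuous_on_lagrange_basis)
  have "integral {0..1} (\<lambda>\<xi>. (g \<xi>)\<^sup>2)
      = integral {0..1} (\<lambda>\<xi>. \<Sum>k<n. \<Sum>l<n. (vec_index v k * vec_index v l) * (lagrange_basis p k \<xi> * lagrange_basis p l \<xi>))"
    by (simp add: g_def power2_eq_square sum_product algebra_simps)
  also have "\<dots> = (\<Sum>k<n. \<Sum>l<n. integral {0..1} (\<lambda>\<xi>. (vec_index v k * vec_index v l) * (lagrange_basis p k \<xi> * lagrange_basis p l \<xi>)))"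
    by (subst Henstock_Kurzweil_Integration.integral_sum, (intro finite_lessThan integrable_sum int)+)
      (intro sum.cong refl Henstock_Kurzweil_Integration.integral_sum finite_lessThan int)
  also have "\<dots> = (\<Sum>k<n. vec_index v k * (\<Sum>l<n. M_mat p $$ (k, l) * vec_index v l))"
    unfolding sum_distrib_left by (intro sum.cong refl) (simp add: M_mat_def n_def)
  also have "\<dots> = 0" using Mv by simp
  finally have "\<forall>\<xi>\<in>{0..1}. (g \<xi>)\<^sup>2 = 0"
    by (subst (asm) integral_eq_0_iff) (auto intro!: continuous_intros contg)
  then have g0: "g \<xi> = 0" if "\<xi> \<in> {0..1}" for \<xi> using that by simp
  have "vec_index v j = 0" if "j < n" for j
  proof -
    have "g (real j / real p) = (\<Sum>k<n. if k = j then vec_index v k else 0)"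
      unfolding g_def using that by (intro sum.cong refl) (auto simp: lagrange_basis_node n_def)
    moreover have "real j / real p \<in> {0..1}" using that by (cases "p = 0") (auto simp: divide_le_eq n_def)
    ultimately show ?thesis using g0 that by simp
  qed
  then have "v = 0\<^sub>v (p + 1)" using v(1) by (intro eq_vecI) (auto simp: n_def)
  then show False using v(2) by blast
qed

lemma M_inv:
  shows M_inv_carrier: "M_inv p \<in> carrier_mat (p + 1) (p + 1)"
    and M_mat_M_inv: "M_mat p * M_inv p = 1\<^sub>m (p + 1)"
proof -
  have "M_mat p \<in> Units (ring_mat TYPE(real) (p + 1) ())"
    by (rule det_non_zero_imp_unit[OF M_mat_carrier det_M_mat])
  then obtain B where B: "mat_inverse (M_mat p) = Some B"
    using mat_inverse(1)[OF M_mat_carrier] by fastforce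
  then show "M_inv p \<in> carrier_mat (p + 1) (p + 1)" "M_mat p * M_inv p = 1\<^sub>m (p + 1)"
    using mat_inverse(2)[OF M_mat_carrier B] by (simp_all add: M_inv_def)
qed

lemma transpose_M_inv: "transpose_mat (M_inv p) = M_inv p"
proof -
  let ?B = "M_inv p"
  have T: "transpose_mat ?B \<in> carrier_mat (p + 1) (p + 1)" using M_inv_carrier by simp
  have "transpose_mat ?B = transpose_mat ?B * (M_mat p * ?B)"
    unfolding M_mat_M_inv by (rule right_mult_one_mat[OF T, symmetric])
  also have "\<dots> = transpose_mat ?B * transpose_mat (M_mat p) * ?B"
    unfolding transpose_M_mat by (rule assoc_mult_mat[OF T M_mat_carrier M_inv_carrier, symmetric])
  also have "transpose_mat ?B * transpose_mat (M_mat p) = 1\<^sub>m (p + 1)"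
    by (subst transpose_mult[OF M_mat_carrier M_inv_carrier, symmetric]) (simp add: M_mat_M_inv)
  also have "1\<^sub>m (p + 1) * ?B = ?B" by (rule left_mult_one_mat[OF M_inv_carrier])
  finally show ?thesis .
qed

text \<open>With \<open>S\<close> the symmetric inverse of the mass matrix, this gives both the
  exchange of \<open>HR_mat\<close> with \<open>HL_mat\<close> and the symmetry of each summand of
  \<open>C_mat\<close>.\<close>

lemma transpose_sandwich:
  fixes A :: "'a::comm_ring_1 mat"
  assumes A: "A \<in> carrier_mat n n" and S: "S \<in> carrier_mat n n" and B: "B \<in> carrier_mat n n"
    and "transpose_mat S = S"
  shows "transpose_mat (transpose_mat A * S * B) = transpose_mat B * S * A"
proof -
  have At: "transpose_mat A \<in> carrier_mat n n" and Bt: "transpose_mat B \<in> carrier_mat n n" using A B by auto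
  show ?thesis
    unfolding transpose_mult[OF mult_carrier_mat[OF At S] B] transpose_mult[OF At S] transpose_transpose assms(4)
    by (rule assoc_mult_mat[OF Bt S A, symmetric])
qed

lemma L_mat_carrier: "L_mat p \<in> carrier_mat (p + 1) (p + 1)" by (simp add: L_mat_def)
lemma R_mat_carrier: "R_mat p \<in> carrier_mat (p + 1) (p + 1)" by (simp add: R_mat_def)

lemma sandwich_carrier:
  assumes "A \<in> carrier_mat n n" "S \<in> carrier_mat n n" "B \<in> carrier_mat n n"
  shows "transpose_mat A * S * B \<in> carrier_mat n n"
  using assms by (intro mult_carrier_mat[of _ n n]) auto

lemma HR_mat_carrier: "HR_mat p \<in> carrier_mat (p + 1) (p + 1)"
  unfolding HR_mat_def by (intro uminus_carrier_mat sandwich_carrier L_mat_carrier R_mat_carrier M_inv_carrier)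

lemma HL_mat_carrier: "HL_mat p \<in> carrier_mat (p + 1) (p + 1)"
  unfolding HL_mat_def by (intro uminus_carrier_mat sandwich_carrier L_mat_carrier R_mat_carrier M_inv_carrier)

lemma C_mat_carrier: "C_mat p \<in> carrier_mat (p + 1) (p + 1)"
  unfolding C_mat_def by (intro add_carrier_mat sandwich_carrier L_mat_carrier R_mat_carrier M_inv_carrier)

lemma transpose_HR_mat: "transpose_mat (HR_mat p) = HL_mat p"
proof -
  have "transpose_mat (- X) = - transpose_mat X" for X :: "real mat" by (intro eq_matI) auto
  then show ?thesis
    unfolding HR_mat_def HL_mat_def
    by (simp only: transpose_sandwich[OF L_mat_carrier M_inv_carrier R_mat_carrier transpose_M_inv])
qed

lemma transpose_HL_mat: "transpose_mat (HL_mat p) = HR_mat p"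
  unfolding transpose_HR_mat[symmetric] by simp

lemma transpose_C_mat: "transpose_mat (C_mat p) = C_mat p"
  unfolding C_mat_def
  by (subst transpose_add[OF sandwich_carrier[OF L_mat_carrier M_inv_carrier L_mat_carrier]
        sandwich_carrier[OF R_mat_carrier M_inv_carrier R_mat_carrier]])
    (simp only: transpose_sandwich[OF L_mat_carrier M_inv_carrier L_mat_carrier transpose_M_inv]
      transpose_sandwich[OF R_mat_carrier M_inv_carrier R_mat_carrier transpose_M_inv])

lemma kron_carrier: "A \<in> carrier_mat a b \<Longrightarrow> B \<in> carrier_mat c d \<Longrightarrow> kron A B \<in> carrier_mat (a * c) (b * d)"
  unfolding kron_def by auto

lemma index_kron:
  assumes "r < dim_row A * dim_row B" "c < dim_col A * dim_col B"
  shows "kron A B $$ (r, c) = A $$ (r div dim_row B, c div dim_col B) * B $$ (r mod dim_row B, c mod dim_col B)"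
  using assms by (simp add: kron_def)

lemma div_mod_less_mult:
  fixes r a b :: nat
  assumes "r < a * b"
  shows "r div b < a" "r mod b < b"
proof -
  have "0 < b" using assms by (cases b) auto
  then show "r div b < a" "r mod b < b" using assms by (auto simp: less_mult_imp_div_less)
qed

lemma transpose_kron: "transpose_mat (kron A B) = kron (transpose_mat A) (transpose_mat B)"
  by (intro eq_matI) (auto simp: kron_def div_mod_less_mult)

lemma block_size_eq: "block_size p = (p + 1) * (p + 1)"
  by (simp add: power2_eq_square)

lemma dg_coeff_carrier: "dg_coeff p j \<in> carrier_mat (block_size p) (block_size p)"
  unfolding dg_coeff_def block_size_eq
  by (simp only: split: if_split)
    (intro conjI impI add_carrier_mat kron_carrier zero_carrier_mat M_mat_carrier C_mat_carrier HR_mat_carrier HL_mat_carrier)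

text \<open>Valid for every offset, including those with zero block. It is the Hermitian symmetry of
  the symbol at the level of Fourier coefficients.\<close>

lemma transpose_dg_coeff: "transpose_mat (dg_coeff p (a, b)) = dg_coeff p (- a, - b)"
proof -
  have "transpose_mat (kron (C_mat p) (M_mat p) + kron (M_mat p) (C_mat p))
      = kron (C_mat p) (M_mat p) + kron (M_mat p) (C_mat p)"
    by (subst transpose_add[OF kron_carrier[OF C_mat_carrier M_mat_carrier] kron_carrier[OF M_mat_carrier C_mat_carrier]])
      (simp only: transpose_kron transpose_C_mat transpose_M_mat)
  then show ?thesis
    by (auto simp: dg_coeff_def transpose_kron transpose_C_mat transpose_M_mat transpose_HR_mat transpose_HL_mat)
qed

section \<open>Fourier coefficients of the symbol\<close>

definition fourier_mode :: "int \<times> int \<Rightarrow> real \<times> real \<Rightarrow> complex" where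
  "fourier_mode = (\<lambda>(j1, j2) (\<theta>1, \<theta>2). exp (\<i> * complex_of_real (of_int j1 * \<theta>1 + of_int j2 * \<theta>2)))"

definition stencil :: "(int \<times> int) set" where
  "stencil = {(0, 0), (-1, 0), (0, -1), (1, 0), (0, 1)}"

lemma finite_stencil: "finite stencil" by (simp add: stencil_def)

lemma stencil_bound: "(j1, j2) \<in> stencil \<Longrightarrow> \<bar>j1\<bar> \<le> 1 \<and> \<bar>j2\<bar> \<le> 1"
  by (auto simp: stencil_def)

lemma dg_coeff_outside_stencil: "j \<notin> stencil \<Longrightarrow> dg_coeff p j = 0\<^sub>m (block_size p) (block_size p)"
  by (auto simp: stencil_def dg_coeff_def)

lemma fourier_mode_add: "fourier_mode (a1 + b1, a2 + b2) \<theta> = fourier_mode (a1, a2) \<theta> * fourier_mode (b1, b2) \<theta>"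
  by (cases \<theta>) (simp add: fourier_mode_def exp_add[symmetric] algebra_simps)

lemma cnj_fourier_mode: "cnj (fourier_mode (a, b) \<theta>) = fourier_mode (- a, - b) \<theta>"
  by (cases \<theta>) (auto simp: fourier_mode_def exp_cnj algebra_simps intro!: arg_cong[where f = exp])



lemma continuous_on_fourier_mode: "continuous_on S (fourier_mode j)"
proof -
  have "fourier_mode j = (\<lambda>\<theta>. exp (\<i> * complex_of_real (of_int (fst j) * fst \<theta> + of_int (snd j) * snd \<theta>)))"
    by (simp add: fourier_mode_def fun_eq_iff split_def)
  then show ?thesis by (simp only:) (intro continuous_intros)
qed

lemma dg_symbol_carrier: "dg_symbol p \<theta> \<in> carrier_mat (block_size p) (block_size p)"
  unfolding dg_symbol_def split_def
  by (intro add_carrier_mat smult_carrier_mat map_carrier_mat[THEN iffD2] dg_coeff_carrier)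

text \<open>Every entry is a trigonometric polynomial over a five-point set; continuity, symmetry
  and Fourier coefficients of the symbol are all read off from this form.\<close>

lemma index_dg_symbol:
  assumes "k < block_size p" "l < block_size p"
  shows "dg_symbol p \<theta> $$ (k, l) = (\<Sum>j\<in>stencil. complex_of_real (dg_coeff p j $$ (k, l)) * fourier_mode j \<theta>)"
proof -
  have d: "dim_row (dg_coeff p j) = block_size p" "dim_col (dg_coeff p j) = block_size p" for j
    using dg_coeff_carrier[of p j] by auto
  show ?thesis
    using assms by (cases \<theta>) (simp add: dg_symbol_def stencil_def fourier_mode_def d algebra_simps)
qed

lemma continuous_on_dg_symbol:
  assumes "k < block_size p" "l < block_size p"
  shows "continuous_on S (\<lambda>\<theta>. dg_symbol p \<theta> $$ (k, l))"
  unfolding index_dg_symbol[OF assms] by (intro continuous_intros continuous_on_fourier_mode)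

lemma index_dg_coeff_uminus:
  assumes "k < block_size p" "l < block_size p"
  shows "dg_coeff p (- a, - b) $$ (k, l) = dg_coeff p (a, b) $$ (l, k)"
  unfolding transpose_dg_coeff[symmetric] using assms dg_coeff_carrier[of p "(a, b)"] by auto

text \<open>Conjugation negates the frequency, transposition negates the offset of the coefficient,
  and the stencil is invariant under negation.\<close>

lemma cnj_dg_symbol:
  assumes "k < block_size p" "l < block_size p"
  shows "cnj (dg_symbol p \<theta> $$ (l, k)) = dg_symbol p \<theta> $$ (k, l)"
proof -
  have "cnj (dg_symbol p \<theta> $$ (l, k))
      = (\<Sum>j\<in>stencil. complex_of_real (dg_coeff p (- fst j, - snd j) $$ (k, l)) * fourier_mode (- fst j, - snd j) \<theta>)"
    unfolding index_dg_symbol[OF assms(2,1)] cnj_sum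
  proof (rule sum.cong[OF refl])
    fix j :: "int \<times> int"
    show "cnj (complex_of_real (dg_coeff p j $$ (l, k)) * fourier_mode j \<theta>)
        = complex_of_real (dg_coeff p (- fst j, - snd j) $$ (k, l)) * fourier_mode (- fst j, - snd j) \<theta>"
      by (cases j) (simp add: cnj_fourier_mode index_dg_coeff_uminus[OF assms])
  qed
  also have "\<dots> = (\<Sum>j\<in>stencil. complex_of_real (dg_coeff p j $$ (k, l)) * fourier_mode j \<theta>)"
    by (rule sum.reindex_bij_witness[of _ "\<lambda>j. (- fst j, - snd j)" "\<lambda>j. (- fst j, - snd j)"])
      (auto simp: stencil_def)
  finally show ?thesis unfolding index_dg_symbol[OF assms] .
qed

lemma mat_adjoint_dg_symbol: "mat_adjoint (dg_symbol p \<theta>) = dg_symbol p \<theta>"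
  unfolding mat_adjoint_eq[OF dg_symbol_carrier]
  by (intro eq_matI) (use dg_symbol_carrier[of p \<theta>] in \<open>auto simp: cnj_dg_symbol\<close>)

lemma integral_exp_period:
  "integral {- pi..pi} (\<lambda>x. exp (\<i> * complex_of_real (of_int q * x))) = 2 * pi * of_bool (q = 0)"
proof (cases "q = 0")
  case False
  define F where "F x = exp (\<i> * of_int q * complex_of_real x) / (\<i> * of_int q)" for x
  have "((\<lambda>x. exp (\<i> * of_int q * complex_of_real x)) has_integral (F pi - F (- pi))) {- pi..pi}"
  proof (rule fundamental_theorem_of_calculus)
    fix x :: real
    have "((\<lambda>z. exp (\<i> * of_int q * z) / (\<i> * of_int q)) has_field_derivative exp (\<i> * of_int q * of_real x)) (at (of_real x))"
      using False by (auto intro!: derivative_eq_intros)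
    then show "(F has_vector_derivative exp (\<i> * of_int q * complex_of_real x)) (at x within {- pi..pi})"
      unfolding F_def by (rule has_vector_derivative_real_field)
  qed simp
  moreover have "exp (\<i> * of_int q * complex_of_real pi) = exp (\<i> * of_int q * complex_of_real (- pi))"
    unfolding exp_eq by (intro exI[of _ q]) (simp add: algebra_simps)
  then have "F pi - F (- pi) = 0" by (simp add: F_def)
  ultimately show ?thesis using False by (simp add: integral_unique mult.assoc)
qed (simp add: scaleR_conv_of_real)

lemma integral_fourier_mode:
  "integral {- pi..pi} (\<lambda>x. integral {- pi..pi} (\<lambda>y. fourier_mode (a, b) (x, y)))
     = complex_of_real ((2 * pi)\<^sup>2) * of_bool ((a, b) = (0, 0))"
proof -
  have "fourier_mode (a, b) (x, y) = exp (\<i> * complex_of_real (of_int a * x)) * exp (\<i> * complex_of_real (of_int b * y))" for x y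
    by (simp add: fourier_mode_def exp_add[symmetric] algebra_simps)
  then have "integral {- pi..pi} (\<lambda>x. integral {- pi..pi} (\<lambda>y. fourier_mode (a, b) (x, y)))
      = integral {- pi..pi} (\<lambda>x. exp (\<i> * complex_of_real (of_int a * x)))
        * integral {- pi..pi} (\<lambda>y. exp (\<i> * complex_of_real (of_int b * y)))"
    by (simp only: Henstock_Kurzweil_Integration.integral_mult_right Henstock_Kurzweil_Integration.integral_mult_left)
  then show ?thesis unfolding integral_exp_period by (simp add: power2_eq_square)
qed

text \<open>\<open>toeplitz2\<close> sees the symbol only through integrals; orthogonality of the
  modes recovers from them the blocks of the scheme.\<close>

lemma fourier_coeff_dg_symbol:
  assumes kl: "k < block_size p" "l < block_size p"
  shows "fourier_coeff (block_size p) (dg_symbol p) (a, b) $$ (k, l) = complex_of_real (dg_coeff p (a, b) $$ (k, l))"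
proof -
  define c where "c j = complex_of_real (dg_coeff p j $$ (k, l))" for j
  define h where "h \<theta> = (\<Sum>j\<in>stencil. c j * fourier_mode (fst j - a, snd j - b) \<theta>)" for \<theta>
  have conth: "continuous_on UNIV h"
    unfolding h_def by (intro continuous_intros continuous_on_fourier_mode)
  have int1: "(\<lambda>y. fourier_mode j (x, y)) integrable_on {- pi..pi}" for j x
    by (intro integrable_continuous_real continuous_on_compose2[OF continuous_on_fourier_mode[of UNIV]] continuous_intros) auto
  have int2: "(\<lambda>x. integral {- pi..pi} (\<lambda>y. fourier_mode j (x, y))) integrable_on {- pi..pi}" for j
  proof -
    have "continuous_on ({- pi..pi} \<times> cbox (- pi) pi) (\<lambda>(x, t). fourier_mode j (x, t))"
      by (simp add: continuous_on_fourier_mode)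
    from integral_continuous_on_param[OF this] show ?thesis by (intro integrable_continuous_real) simp
  qed
  have "fourier_coeff (block_size p) (dg_symbol p) (a, b) $$ (k, l)
      = (LINT \<theta>|lebesgue_on symbol_domain. h \<theta>) / complex_of_real ((2 * pi)\<^sup>2)"
  proof -
    have eq: "dg_symbol p (\<theta>1, \<theta>2) $$ (k, l) * exp (- (\<i> * complex_of_real (of_int a * \<theta>1 + of_int b * \<theta>2))) = h (\<theta>1, \<theta>2)" for \<theta>1 \<theta>2
    proof -
      have "exp (- (\<i> * complex_of_real (of_int a * \<theta>1 + of_int b * \<theta>2))) = fourier_mode (- a, - b) (\<theta>1, \<theta>2)"
        by (auto simp: fourier_mode_def algebra_simps intro!: arg_cong[where f = exp])
      moreover have "fourier_mode (fst j - a, snd j - b) (\<theta>1, \<theta>2) = fourier_mode j (\<theta>1, \<theta>2) * fourier_mode (- a, - b) (\<theta>1, \<theta>2)" for j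
        using fourier_mode_add[of "fst j" "- a" "snd j" "- b"] by simp
      ultimately show ?thesis unfolding index_dg_symbol[OF kl] h_def c_def
        by (simp add: sum_distrib_right mult.assoc)
    qed
    have "(\<lambda>(\<theta>1, \<theta>2). dg_symbol p (\<theta>1, \<theta>2) $$ (k, l)
        * exp (- (\<i> * complex_of_real (of_int a * \<theta>1 + of_int b * \<theta>2)))) = h"
      unfolding eq by simp
    then show ?thesis unfolding fourier_coeff_def prod.case by (subst index_mat(1)[OF kl]) (simp only: prod.case)
  qed
  also have "(LINT \<theta>|lebesgue_on symbol_domain. h \<theta>)
      = (\<Sum>j\<in>stencil. c j * integral {- pi..pi} (\<lambda>x. integral {- pi..pi} (\<lambda>y. fourier_mode (fst j - a, snd j - b) (x, y))))"
    unfolding lebesgue_integral_symbol_domain[OF conth] unfolding h_def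
    by (simp add: Henstock_Kurzweil_Integration.integral_sum finite_stencil integrable_on_mult_right[OF int1]
        integrable_on_mult_right[OF int2])
  also have "\<dots> = (\<Sum>j\<in>stencil. if j = (a, b) then c (a, b) * complex_of_real ((2 * pi)\<^sup>2) else 0)"
    unfolding integral_fourier_mode by (intro sum.cong refl) auto
  also have "\<dots> = c (a, b) * complex_of_real ((2 * pi)\<^sup>2)"
    \<comment> \<open>For an offset outside the stencil no term of the sum survives, in agreement
      with the zero block.\<close>
    using dg_coeff_outside_stencil[of "(a, b)" p] kl by (auto simp: finite_stencil c_def)
  finally show ?thesis by (simp add: c_def)
qed

lemma sum_sum_delta:
  assumes "finite S" "finite T" "a \<in> S" "b \<in> T"
  shows "(\<Sum>x\<in>S. \<Sum>y\<in>T. if x = a then if y = b then z else 0 else 0) = (z :: 'a::comm_monoid_add)"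
proof -
  have "(\<Sum>y\<in>T. if x = a then if y = b then z else 0 else 0) = (if x = a then z else 0)" for x
    using assms by (cases "x = a") simp_all
  then show ?thesis using assms by simp
qed

section \<open>Entries of the two-level Toeplitz matrix\<close>

text \<open>At a given position exactly one pair of shift matrices has a nonzero entry, namely the
  pair whose shifts are the differences of the element coordinates.\<close>

lemma toeplitz2_entry:
  assumes r: "r < n1 * n2 * s" and c: "c < n1 * n2 * s"
  shows "toeplitz2 s n1 n2 f $$ (r, c) = fourier_coeff s f
      (int (r div s div n2) - int (c div s div n2), int (r div s mod n2) - int (c div s mod n2)) $$ (r mod s, c mod s)"
proof -
  define i1 where "i1 = r div s div n2"
  define i2 where "i2 = r div s mod n2"
  define h1 where "h1 = c div s div n2"
  define h2 where "h2 = c div s mod n2"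
  have b: "i1 < n1" "i2 < n2" "h1 < n1" "h2 < n2"
    using div_mod_less_mult[OF div_mod_less_mult(1)[OF r]] div_mod_less_mult[OF div_mod_less_mult(1)[OF c]]
    by (simp_all add: i1_def i2_def h1_def h2_def)
  note rc = div_mod_less_mult[OF r] div_mod_less_mult[OF c]
  have "kron (kron (shift_mat n1 j1) (shift_mat n2 j2)) (fourier_coeff s f (j1, j2)) $$ (r, c)
      = (if j1 = int i1 - int h1 then if j2 = int i2 - int h2 then
          fourier_coeff s f (int i1 - int h1, int i2 - int h2) $$ (r mod s, c mod s) else 0 else 0)" for j1 j2
  proof -
    have F: "dim_row (fourier_coeff s f (j1, j2)) = s" "dim_col (fourier_coeff s f (j1, j2)) = s"
      by (simp_all add: fourier_coeff_def)
    have S: "dim_row (shift_mat n j) = n" "dim_col (shift_mat n j) = n" for n j by (simp_all add: shift_mat_def)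
    have K: "dim_row (kron (shift_mat n1 j1) (shift_mat n2 j2)) = n1 * n2"
      "dim_col (kron (shift_mat n1 j1) (shift_mat n2 j2)) = n1 * n2" by (simp_all add: kron_def S)
    have "kron (kron (shift_mat n1 j1) (shift_mat n2 j2)) (fourier_coeff s f (j1, j2)) $$ (r, c)
        = shift_mat n1 j1 $$ (i1, h1) * shift_mat n2 j2 $$ (i2, h2) * fourier_coeff s f (j1, j2) $$ (r mod s, c mod s)"
      using r c rc by (simp add: index_kron F S K i1_def i2_def h1_def h2_def)
    then show ?thesis using b by (auto simp: shift_mat_def)
  qed
  moreover have "int i1 - int h1 \<in> {- (int n1 - 1)..int n1 - 1}" "int i2 - int h2 \<in> {- (int n2 - 1)..int n2 - 1}"
    using b by auto
  ultimately show ?thesis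
    using r c sum_sum_delta[of "{- (int n1 - 1)..int n1 - 1}" "{- (int n2 - 1)..int n2 - 1}" "int i1 - int h1" "int i2 - int h2"]
    by (simp add: toeplitz2_def i1_def[symmetric] i2_def[symmetric] h1_def[symmetric] h2_def[symmetric])
qed

lemma toeplitz2_dg_symbol_entry:
  assumes r: "r < n1 * n2 * block_size p" and c: "c < n1 * n2 * block_size p"
  shows "toeplitz2 (block_size p) n1 n2 (dg_symbol p) $$ (r, c) = complex_of_real (dg_coeff p
      (int (r div block_size p div n2) - int (c div block_size p div n2),
       int (r div block_size p mod n2) - int (c div block_size p mod n2)) $$ (r mod block_size p, c mod block_size p))"
  unfolding toeplitz2_entry[OF assms]
  by (rule fourier_coeff_dg_symbol) (rule div_mod_less_mult(2)[OF r] div_mod_less_mult(2)[OF c])+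

section \<open>Continuity of eigenvalue sums\<close>

text \<open>All spectra involved are real, so only the restriction of the test function to the real
  line matters.\<close>

lemma compact_support_on_reals:
  fixes \<Phi> :: "complex \<Rightarrow> complex"
  assumes "continuous_on UNIV \<Phi>" "compact (closure {z. \<Phi> z \<noteq> 0})"
  obtains R where "continuous_on UNIV (\<lambda>x. \<Phi> (complex_of_real x))"
    "\<And>x. R < \<bar>x\<bar> \<Longrightarrow> \<Phi> (complex_of_real x) = 0"
proof -
  obtain R where R: "\<And>z. z \<in> closure {z. \<Phi> z \<noteq> 0} \<Longrightarrow> norm z \<le> R"
    using compact_imp_bounded[OF assms(2)] unfolding bounded_iff by blast
  show ?thesis
  proof (rule that[of R])
    show "continuous_on UNIV (\<lambda>x. \<Phi> (complex_of_real x))"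
      by (intro continuous_on_compose2[OF assms(1)] continuous_intros) auto
    fix x :: real assume "R < \<bar>x\<bar>"
    then show "\<Phi> (complex_of_real x) = 0"
      using R[of "complex_of_real x"] closure_subset[of "{z. \<Phi> z \<noteq> 0}"] by fastforce
  qed
qed

text \<open>Points closer than \<delta> are handled by uniform continuity; for the others (a - b)
  squared over \<delta> squared is at least 1 and absorbs the trivial bound \<open>2 * B\<close>.
  The quadratic form matches the squared Frobenius distance in
  \<open>spectral_sum_perturbation\<close>.\<close>

lemma quadratic_modulus:
  fixes \<phi> :: "real \<Rightarrow> complex" and \<epsilon> :: real
  assumes cont: "continuous_on UNIV \<phi>" and supp: "\<And>x. R < \<bar>x\<bar> \<Longrightarrow> \<phi> x = 0" and "0 < \<epsilon>"
  obtains C :: real where "0 \<le> C" "\<And>a b. norm (\<phi> a - \<phi> b) \<le> \<epsilon> + C * (a - b)\<^sup>2"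
proof -
  obtain \<delta> where \<delta>: "0 < \<delta>" "\<And>x y. \<bar>x - y\<bar> < \<delta> \<Longrightarrow> norm (\<phi> x - \<phi> y) < \<epsilon>"
    using compact_support_uniformly_continuous[OF cont supp \<open>0 < \<epsilon>\<close>] by blast
  obtain B where B: "0 \<le> B" "\<And>x. norm (\<phi> x) \<le> B"
    using compact_support_bounded[OF cont supp] by blast
  show ?thesis
  proof (rule that[of "2 * B / \<delta>\<^sup>2"])
    show "0 \<le> 2 * B / \<delta>\<^sup>2" using B by simp
    fix a b
    show "norm (\<phi> a - \<phi> b) \<le> \<epsilon> + 2 * B / \<delta>\<^sup>2 * (a - b)\<^sup>2"
    proof (cases "\<bar>a - b\<bar> < \<delta>")
      case True
      then have "norm (\<phi> a - \<phi> b) \<le> \<epsilon>" using \<delta>(2) less_imp_le by blast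
      moreover have "0 \<le> 2 * B / \<delta>\<^sup>2 * (a - b)\<^sup>2" using B by simp
      ultimately show ?thesis by linarith
    next
      case False
      then have "\<delta>\<^sup>2 \<le> (a - b)\<^sup>2" using \<delta>(1) by (metis abs_le_square_iff abs_of_pos not_less)
      then have "2 * B / \<delta>\<^sup>2 * \<delta>\<^sup>2 \<le> 2 * B / \<delta>\<^sup>2 * (a - b)\<^sup>2" using B by (intro mult_left_mono) auto
      moreover have "norm (\<phi> a - \<phi> b) \<le> 2 * B" using B(2)[of a] B(2)[of b] norm_triangle_ineq4[of "\<phi> a" "\<phi> b"] by linarith
      ultimately show ?thesis using \<delta>(1) \<open>0 < \<epsilon>\<close> by simp
    qed
  qed
qed

lemma continuous_on_eigenvalue_sum:
  fixes f :: "'b::metric_space \<Rightarrow> complex mat" and \<Phi> :: "complex \<Rightarrow> complex"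
  assumes f: "\<And>\<theta>. f \<theta> \<in> carrier_mat s s" "\<And>\<theta>. mat_adjoint (f \<theta>) = f \<theta>"
    and cont: "\<And>k l. k < s \<Longrightarrow> l < s \<Longrightarrow> continuous_on UNIV (\<lambda>\<theta>. f \<theta> $$ (k, l))"
    and \<Phi>: "continuous_on UNIV \<Phi>" "compact (closure {z. \<Phi> z \<noteq> 0})"
  shows "continuous_on UNIV (\<lambda>\<theta>. \<Sum>z\<in>#eigenvalue_mset (f \<theta>). \<Phi> z)"
proof -
  define \<phi> where "\<phi> x = \<Phi> (complex_of_real x)" for x
  obtain R where R: "continuous_on UNIV \<phi>" "\<And>x. R < \<bar>x\<bar> \<Longrightarrow> \<phi> x = 0"
    using compact_support_on_reals[OF \<Phi>] unfolding \<phi>_def by blast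
  define h where "h \<theta> = (\<Sum>z\<in>#eigenvalue_mset (f \<theta>). \<Phi> z)" for \<theta>
  have "(h \<longlongrightarrow> h \<theta>0) (at \<theta>0)" for \<theta>0
  proof (rule tendstoI)
    fix e :: real assume "0 < e"
    \<comment> \<open>Makes \<open>\<epsilon> * s\<close> at most \<open>e / 2\<close>; the added 1
      keeps the denominator positive for \<open>s = 0\<close>.\<close>
    define \<epsilon> where "\<epsilon> = e / (2 * (real s + 1))"
    have "0 < \<epsilon>" using \<open>0 < e\<close> by (simp add: \<epsilon>_def)
    then obtain C where C: "0 \<le> C" "\<And>a b. norm (\<phi> a - \<phi> b) \<le> \<epsilon> + C * (a - b)\<^sup>2"
      using quadratic_modulus[OF R] by blast
    define D where "D \<theta> = (\<Sum>x<s. \<Sum>y<s. (cmod (f \<theta> $$ (x, y) - f \<theta>0 $$ (x, y)))\<^sup>2)" for \<theta>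
    have bound: "norm (h \<theta> - h \<theta>0) \<le> \<epsilon> * real s + C * D \<theta>" for \<theta>
    proof -
      obtain w \<alpha> where w: "spectral_family {..<s} (\<lambda>x y. f \<theta> $$ (x, y)) {..<s} w \<alpha>" "orthonormal_on {..<s} {..<s} w"
        "eigenvalue_mset (f \<theta>) = image_mset (\<lambda>j. complex_of_real (\<alpha> j)) (mset_set {..<s})"
        using hermitian_spectral_family[OF f] by blast
      obtain u \<beta> where u: "spectral_family {..<s} (\<lambda>x y. f \<theta>0 $$ (x, y)) {..<s} u \<beta>" "orthonormal_on {..<s} {..<s} u"
        "eigenvalue_mset (f \<theta>0) = image_mset (\<lambda>j. complex_of_real (\<beta> j)) (mset_set {..<s})"
        using hermitian_spectral_family[OF f] by blast
      have "h \<theta> = (\<Sum>j<s. \<phi> (\<alpha> j))" "h \<theta>0 = (\<Sum>j<s. \<phi> (\<beta> j))"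
        by (simp_all add: h_def w(3) u(3) \<phi>_def image_mset.compositionality comp_def sum_unfold_sum_mset)
      then show ?thesis using spectral_sum_perturbation[OF w(1,2) u(1,2) C(2)] by (simp add: D_def)
    qed
    have "continuous_on UNIV D" unfolding D_def by (intro continuous_intros cont) auto
    then have "(D \<longlongrightarrow> D \<theta>0) (at \<theta>0)" by (simp add: continuous_on_def)
    then have "((\<lambda>\<theta>. C * D \<theta>) \<longlongrightarrow> C * D \<theta>0) (at \<theta>0)" by (intro tendsto_intros)
    moreover have "C * D \<theta>0 = 0" by (simp add: D_def)
    ultimately have "\<forall>\<^sub>F \<theta> in at \<theta>0. C * D \<theta> < e / 2"
      using \<open>0 < e\<close> by (intro order_tendstoD(2)) auto
    then show "\<forall>\<^sub>F \<theta> in at \<theta>0. dist (h \<theta>) (h \<theta>0) < e"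
    proof eventually_elim
      case (elim \<theta>)
      have "\<epsilon> * real s \<le> e / 2" using \<open>0 < e\<close> by (simp add: \<epsilon>_def field_simps)
      then show ?case using bound[of \<theta>] elim by (simp add: dist_norm)
    qed
  qed
  then show ?thesis unfolding h_def[symmetric] by (simp add: continuous_on_def)
qed

section \<open>The low-rank perturbation\<close>

text \<open>Subadditivity of the rank, each summand being an outer product.\<close>

lemma (in vec_space) rank_le_card_sum_products:
  assumes "finite T" "A \<in> carrier_mat n nc"
    and "\<And>r c. r < n \<Longrightarrow> c < nc \<Longrightarrow> A $$ (r, c) = (\<Sum>t\<in>T. f t r * g t c)"
  shows "rank A \<le> card T"
  using assms
proof (induction T arbitrary: A rule: finite_induct)
  case empty
  then have "A = 0\<^sub>m n nc" by (intro eq_matI) auto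
  then show ?case by (simp add: rank_0I)
next
  case (insert t T)
  define A1 where "A1 = Matrix.mat n nc (\<lambda>(r, c). f t r * g t c)"
  define A2 where "A2 = Matrix.mat n nc (\<lambda>(r, c). \<Sum>t\<in>T. f t r * g t c)"
  have carr: "A1 \<in> carrier_mat n nc" "A2 \<in> carrier_mat n nc" by (simp_all add: A1_def A2_def)
  have "A = A1 + A2" using insert.prems insert.hyps by (intro eq_matI) (auto simp: A1_def A2_def)
  then have "rank A \<le> rank A1 + rank A2" using rank_subadditive[OF carr] by simp
  moreover have "rank A1 \<le> 1" by (rule rank_le_1_product_entries[OF carr(1)]) (simp add: A1_def)
  moreover have "rank A2 \<le> card T" by (rule insert.IH[OF carr(2)]) (simp add: A2_def)
  ultimately show ?case using insert.hyps by simp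
qed

lemma (in vec_space) rank_le_card_nonzero_rows:
  assumes "S \<subseteq> {..<n}" "A \<in> carrier_mat n nc"
    and "\<And>r c. r < n \<Longrightarrow> c < nc \<Longrightarrow> r \<notin> S \<Longrightarrow> A $$ (r, c) = 0"
  shows "rank A \<le> card S"
proof (rule rank_le_card_sum_products[OF _ assms(2)])
  show fin: "finite S" using assms(1) finite_subset by blast
  fix r c assume "r < n" "c < nc"
  have "(\<Sum>t\<in>S. of_bool (r = t) * A $$ (t, c)) = (\<Sum>t\<in>S. if r = t then A $$ (r, c) else 0)"
    by (intro sum.cong) auto
  then show "A $$ (r, c) = (\<Sum>t\<in>S. of_bool (r = t) * A $$ (t, c))"
    using assms(3)[of r c] \<open>r < n\<close> \<open>c < nc\<close> fin by auto
qed

section \<open>Numbering of the unknowns by element and local index\<close>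

definition index_set :: "nat \<Rightarrow> nat \<Rightarrow> nat \<Rightarrow> (nat \<times> nat \<times> nat) set" where
  "index_set n1 n2 s = {..<n1} \<times> {..<n2} \<times> {..<s}"

text \<open>The unknowns of the elements adjacent to the boundary, whose rows
  \<open>pressure_matrix\<close> does not prescribe.\<close>

definition boundary_set :: "nat \<Rightarrow> nat \<Rightarrow> nat \<Rightarrow> (nat \<times> nat \<times> nat) set" where
  "boundary_set n1 n2 s = {(i, j, k) \<in> index_set n1 n2 s. \<not> (1 \<le> i \<and> i + 1 < n1 \<and> 1 \<le> j \<and> j + 1 < n2)}"

definition flat_index :: "nat \<Rightarrow> nat \<Rightarrow> nat \<times> nat \<times> nat \<Rightarrow> nat" where
  "flat_index n2 s = (\<lambda>(i, j, k). (i * n2 + j) * s + k)"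

lemma finite_index_set: "finite (index_set n1 n2 s)" by (simp add: index_set_def)

lemma card_index_set: "card (index_set n1 n2 s) = n1 * n2 * s"
  by (simp add: index_set_def card_cartesian_product)

lemma boundary_subset: "boundary_set n1 n2 s \<subseteq> index_set n1 n2 s" by (auto simp: boundary_set_def)

text \<open>Two strips of elements in each direction; the two strips may coincide or overlap, so
  only an upper bound is claimed.\<close>

lemma card_boundary_set: "card (boundary_set n1 n2 s) \<le> 2 * s * (n1 + n2)"
proof -
  have two: "card {a, b} \<le> 2" for a b :: nat by (simp add: card_insert_if)
  have "boundary_set n1 n2 s \<subseteq> {0, n1 - 1} \<times> {..<n2} \<times> {..<s} \<union> {..<n1} \<times> {0, n2 - 1} \<times> {..<s}"
    by (auto simp: boundary_set_def index_set_def)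
  then have "card (boundary_set n1 n2 s)
      \<le> card ({0, n1 - 1} \<times> {..<n2} \<times> {..<s} \<union> {..<n1} \<times> {0, n2 - 1} \<times> {..<s})"
    by (intro card_mono) auto
  also have "\<dots> \<le> card ({0, n1 - 1} \<times> {..<n2} \<times> {..<s}) + card ({..<n1} \<times> {0, n2 - 1} \<times> {..<s})"
    by (rule card_Un_le)
  also have "\<dots> = card {0, n1 - 1} * (n2 * s) + n1 * (card {0, n2 - 1} * s)"
    by (simp only: card_cartesian_product card_lessThan)
  also have "\<dots> \<le> 2 * (n2 * s) + n1 * (2 * s)"
    by (intro add_mono mult_mono two order_refl) auto
  finally show ?thesis by (simp add: algebra_simps)
qed

lemma mult_add_less_mult:
  fixes a b m n :: nat
  assumes "a < m" "b < n"
  shows "a * n + b < m * n"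
proof -
  have "a * n + b < Suc a * n" using assms by simp
  also have "\<dots> \<le> m * n" using assms by (intro mult_right_mono) auto
  finally show ?thesis .
qed

lemma flat_index_decode:
  assumes "(i, j, k) \<in> index_set n1 n2 s"
  shows "flat_index n2 s (i, j, k) < n1 * n2 * s" "flat_index n2 s (i, j, k) mod s = k"
    "flat_index n2 s (i, j, k) div s div n2 = i" "flat_index n2 s (i, j, k) div s mod n2 = j"
proof -
  have b: "i < n1" "j < n2" "k < s" using assms by (auto simp: index_set_def)
  have "i * n2 + j < n1 * n2" using b by (intro mult_add_less_mult)
  then show "flat_index n2 s (i, j, k) < n1 * n2 * s"
    unfolding flat_index_def prod.case using b by (intro mult_add_less_mult)
  show "flat_index n2 s (i, j, k) mod s = k" using b by (simp add: flat_index_def)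
  have "flat_index n2 s (i, j, k) div s = i * n2 + j" using b by (simp add: flat_index_def)
  then show "flat_index n2 s (i, j, k) div s div n2 = i" "flat_index n2 s (i, j, k) div s mod n2 = j"
    using b by simp_all
qed

lemma inj_on_flat_index: "inj_on (flat_index n2 s) (index_set n1 n2 s)"
proof (rule inj_onI)
  fix x y assume "x \<in> index_set n1 n2 s" "y \<in> index_set n1 n2 s" "flat_index n2 s x = flat_index n2 s y"
  then show "x = y" using flat_index_decode[of _ _ _ n1 n2 s] by (cases x; cases y) metis
qed

lemma flat_index_encode:
  assumes "r < n1 * n2 * s"
  shows "(r div s div n2, r div s mod n2, r mod s) \<in> index_set n1 n2 s"
    "flat_index n2 s (r div s div n2, r div s mod n2, r mod s) = r"
  using div_mod_less_mult[OF assms] div_mod_less_mult[OF div_mod_less_mult(1)[OF assms]]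
  by (auto simp: index_set_def flat_index_def)

text \<open>Only the row must belong to an interior element. The freedom in the column is what
  confines the perturbation to the boundary rows.\<close>

lemma pressure_matrix_interior_row:
  assumes K: "pressure_matrix p n1 n2 K"
    and x: "(i, j, k) \<in> index_set n1 n2 (block_size p) - boundary_set n1 n2 (block_size p)"
    and y: "(i', j', l) \<in> index_set n1 n2 (block_size p)"
  shows "K $$ (flat_index n2 (block_size p) (i, j, k), flat_index n2 (block_size p) (i', j', l))
       = dg_coeff p (int i - int i', int j - int j') $$ (k, l)"
proof -
  have "matrix_block (block_size p) n2 K (i, j) (i', j') = dg_coeff p (int i - int i', int j - int j')"
    using K x y by (auto simp: pressure_matrix_def boundary_set_def index_set_def)
  moreover have "matrix_block (block_size p) n2 K (i, j) (i', j') $$ (k, l)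
      = K $$ (flat_index n2 (block_size p) (i, j, k), flat_index n2 (block_size p) (i', j', l))"
    using x y by (simp add: matrix_block_def flat_index_def index_set_def)
  ultimately show ?thesis by simp
qed

text \<open>The difference to the Toeplitz matrix vanishes in every interior row, so its rank is at
  most the number of boundary rows, whatever the boundary conditions put there.\<close>

lemma pressure_matrix_decomposition:
  assumes K: "pressure_matrix p n1 n2 K"
  defines "s \<equiv> block_size p"
  obtains E where "E \<in> carrier_mat (n1 * n2 * s) (n1 * n2 * s)"
    "cmat K = toeplitz2 s n1 n2 (dg_symbol p) + E"
    "vec_space.rank (n1 * n2 * s) E \<le> 2 * s * (n1 + n2)"
proof -
  define N where "N = n1 * n2 * s"
  define T where "T = toeplitz2 s n1 n2 (dg_symbol p)"
  have Kc: "cmat K \<in> carrier_mat N N" using K by (simp add: pressure_matrix_def N_def s_def)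
  have Tc: "T \<in> carrier_mat N N" by (simp add: T_def toeplitz2_def N_def)
  define E where "E = cmat K - T"
  have Ec: "E \<in> carrier_mat N N" unfolding E_def by (rule minus_carrier_mat[OF Tc])
  have "cmat K = T + E" unfolding E_def using Kc Tc by (intro eq_matI) auto
  moreover have "vec_space.rank N E \<le> card (flat_index n2 s ` boundary_set n1 n2 s)"
  proof (rule vec_space.rank_le_card_nonzero_rows[OF _ Ec])
    show "flat_index n2 s ` boundary_set n1 n2 s \<subseteq> {..<N}"
      using flat_index_decode(1)[of _ _ _ n1 n2 s] boundary_subset[of n1 n2 s] by (auto simp: N_def)
    fix r c assume rc: "r < N" "c < N" "r \<notin> flat_index n2 s ` boundary_set n1 n2 s"
    note r = flat_index_encode[OF rc(1)[unfolded N_def]] and c = flat_index_encode[OF rc(2)[unfolded N_def]]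
    have "(r div s div n2, r div s mod n2, r mod s) \<in> index_set n1 n2 s - boundary_set n1 n2 s"
      using r rc(3) by (metis DiffI imageI)
    from pressure_matrix_interior_row[OF K this[unfolded s_def] c(1)[unfolded s_def], folded s_def]
    have "K $$ (r, c) = dg_coeff p (int (r div s div n2) - int (c div s div n2), int (r div s mod n2) - int (c div s mod n2)) $$ (r mod s, c mod s)"
      unfolding r(2) c(2) .
    then have "cmat K $$ (r, c) = T $$ (r, c)"
      using rc Kc toeplitz2_dg_symbol_entry[of r n1 n2 p c] by (simp add: T_def N_def s_def)
    then show "E $$ (r, c) = 0" unfolding E_def using rc Kc Tc by simp
  qed
  moreover have "card (flat_index n2 s ` boundary_set n1 n2 s) \<le> 2 * s * (n1 + n2)"
    using card_image_le[of "boundary_set n1 n2 s" "flat_index n2 s"] card_boundary_set[of n1 n2 s]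
      finite_subset[OF boundary_subset finite_index_set] by (meson order_trans)
  ultimately show ?thesis using that[of E] Ec unfolding N_def T_def by (meson order_trans)
qed

section \<open>The circulant comparison matrix\<close>

text \<open>A geometric sum up to the phase caused by the start at -pi. The bound on
  \<open>q\<close> excludes aliasing: a nonzero multiple of \<open>n\<close> would give a sum of
  modulus \<open>n\<close>.\<close>

lemma sum_exp_grid:
  assumes "\<bar>q\<bar> < int n"
  shows "(\<Sum>m<n. exp (\<i> * complex_of_real (of_int q * grid_point n m))) = of_nat n * of_bool (q = 0)"
proof (cases "q = 0")
  case False
  have n: "0 < n" using assms by auto
  define z where "z = exp (2 * of_real pi * \<i> * of_int q / of_nat n)"
  have "exp (\<i> * complex_of_real (of_int q * grid_point n m)) = exp (- (\<i> * of_int q * of_real pi)) * z ^ m" for m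
    unfolding z_def exp_of_nat_mult[symmetric] exp_add[symmetric]
    by (rule arg_cong[where f = exp]) (simp add: grid_point_def algebra_simps)
  then have "(\<Sum>m<n. exp (\<i> * complex_of_real (of_int q * grid_point n m))) = exp (- (\<i> * of_int q * of_real pi)) * (\<Sum>m<n. z ^ m)"
    by (simp add: sum_distrib_left)
  moreover have "z ^ n = 1"
  proof -
    have "z ^ n = exp (2 * of_real pi * \<i> * of_int q)"
      unfolding z_def exp_of_nat_mult[symmetric] using n by simp
    also have "\<dots> = 1" unfolding exp_eq_1 by (auto intro!: exI[of _ q])
    finally show ?thesis .
  qed
  moreover have "z \<noteq> 1"
  proof
    assume "z = 1"
    then obtain l :: int where "2 * pi * of_int q / real n = of_int (2 * l) * pi"
      unfolding z_def exp_eq_1 by auto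
    then have "real_of_int q = of_int (l * int n)" using n by (simp add: field_simps)
    then have "q = l * int n" by (simp only: of_int_eq_iff)
    moreover from this False have "l \<noteq> 0" by auto
    then have "1 \<le> \<bar>l\<bar>" by simp
    then have "1 * int n \<le> \<bar>l\<bar> * int n" by (intro mult_right_mono) auto
    ultimately show False using assms by (simp add: abs_mult)
  qed
  ultimately show ?thesis using False by (simp add: geometric_sum)
qed simp

lemma sum_fourier_mode_grid:
  assumes "\<bar>q1\<bar> < int n1" "\<bar>q2\<bar> < int n2"
  shows "(\<Sum>m1<n1. \<Sum>m2<n2. fourier_mode (q1, q2) (grid_point n1 m1, grid_point n2 m2))
    = of_nat (n1 * n2) * of_bool ((q1, q2) = (0, 0))"
proof -
  have "fourier_mode (q1, q2) (x, y) = exp (\<i> * complex_of_real (of_int q1 * x)) * exp (\<i> * complex_of_real (of_int q2 * y))" for x y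
    by (simp add: fourier_mode_def exp_add[symmetric] algebra_simps)
  then have "(\<Sum>m1<n1. \<Sum>m2<n2. fourier_mode (q1, q2) (grid_point n1 m1, grid_point n2 m2))
      = (\<Sum>m1<n1. exp (\<i> * complex_of_real (of_int q1 * grid_point n1 m1)))
        * (\<Sum>m2<n2. exp (\<i> * complex_of_real (of_int q2 * grid_point n2 m2)))"
    by (simp only: sum_product)
  then show ?thesis unfolding sum_exp_grid[OF assms(1)] sum_exp_grid[OF assms(2)] by simp
qed

text \<open>The tensor product of a normalized Fourier mode with a vector of the family sampled at
  the same frequency. The negative exponent makes the entry at (a, b) extract the Fourier
  coefficient of index a - b, the Toeplitz convention.\<close>

definition circulant_vector ::
  "(real \<times> real \<Rightarrow> nat \<Rightarrow> nat \<Rightarrow> complex) \<Rightarrow> nat \<Rightarrow> nat \<Rightarrow> nat \<times> nat \<times> nat \<Rightarrow> nat \<times> nat \<times> nat \<Rightarrow> complex" where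
  "circulant_vector w n1 n2 = (\<lambda>(m1, m2, t) (a1, a2, k).
     fourier_mode (- int a1, - int a2) (grid_point n1 m1, grid_point n2 m2)
       * w (grid_point n1 m1, grid_point n2 m2) t k / complex_of_real (sqrt (real (n1 * n2))))"

text \<open>One computation serves twice: weights 1 give the completeness relation, and eigenvalues
  of the symbol as weights give the matrix entries.\<close>

lemma circulant_vector_sum:
  assumes n: "0 < n1" "0 < n2"
    and G: "\<And>\<theta>. (\<Sum>t<s. c \<theta> t * (w \<theta> t k * cnj (w \<theta> t l))) = G \<theta>"
  shows "(\<Sum>(m1, m2, t)\<in>index_set n1 n2 s. c (grid_point n1 m1, grid_point n2 m2) t *
      (circulant_vector w n1 n2 (m1, m2, t) (a1, a2, k) * cnj (circulant_vector w n1 n2 (m1, m2, t) (b1, b2, l))))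
    = (\<Sum>m1<n1. \<Sum>m2<n2. fourier_mode (int b1 - int a1, int b2 - int a2) (grid_point n1 m1, grid_point n2 m2)
        * G (grid_point n1 m1, grid_point n2 m2)) / of_nat (n1 * n2)"
proof -
  define r where "r = complex_of_real (sqrt (real (n1 * n2)))"
  have rr: "r * cnj r = of_nat (n1 * n2)"
  proof -
    have "r * cnj r = complex_of_real (sqrt (real (n1 * n2)) * sqrt (real (n1 * n2)))"      unfolding r_def complex_cnj_complex_of_real of_real_mult ..
    then show ?thesis unfolding real_sqrt_mult_self by simp
  qed
  have summand: "c \<theta> t * ((fourier_mode (- int a1, - int a2) \<theta> * w \<theta> t k / r) * cnj (fourier_mode (- int b1, - int b2) \<theta> * w \<theta> t l / r))
      = fourier_mode (int b1 - int a1, int b2 - int a2) \<theta> * (c \<theta> t * (w \<theta> t k * cnj (w \<theta> t l))) / of_nat (n1 * n2)" for \<theta> t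
  proof -
    have "fourier_mode (int b1 - int a1, int b2 - int a2) \<theta> = fourier_mode (- int a1, - int a2) \<theta> * cnj (fourier_mode (- int b1, - int b2) \<theta>)"
      unfolding cnj_fourier_mode fourier_mode_add[symmetric] by simp
    then show ?thesis unfolding rr[symmetric] by (simp add: mult_ac)
  qed
  have "(\<Sum>(m1, m2, t)\<in>index_set n1 n2 s. c (grid_point n1 m1, grid_point n2 m2) t *
      (circulant_vector w n1 n2 (m1, m2, t) (a1, a2, k) * cnj (circulant_vector w n1 n2 (m1, m2, t) (b1, b2, l))))
    = (\<Sum>m1<n1. \<Sum>m2<n2. \<Sum>t<s. c (grid_point n1 m1, grid_point n2 m2) t *
      (circulant_vector w n1 n2 (m1, m2, t) (a1, a2, k) * cnj (circulant_vector w n1 n2 (m1, m2, t) (b1, b2, l))))"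
    unfolding index_set_def by (simp only: sum.cartesian_product prod.case_distrib)
  also have "\<dots> = (\<Sum>m1<n1. \<Sum>m2<n2. fourier_mode (int b1 - int a1, int b2 - int a2) (grid_point n1 m1, grid_point n2 m2)
        * G (grid_point n1 m1, grid_point n2 m2) / of_nat (n1 * n2))"
    unfolding circulant_vector_def prod.case r_def[symmetric] summand G[symmetric] sum_distrib_left sum_divide_distrib ..
  finally show ?thesis by (simp only: sum_divide_distrib)
qed

text \<open>The circulant that the sampled symbol diagonalizes: since the sampling points start at \<open>- pi\<close>
  it is skew, but away from the boundary no coefficient wraps around.\<close>

lemma circulant_spectral_family:
  assumes n: "0 < n1" "0 < n2"
    and w: "\<And>\<theta>. spectral_family {..<block_size p} (\<lambda>x y. dg_symbol p \<theta> $$ (x, y)) {..<block_size p} (w \<theta>) (\<alpha> \<theta>)"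
  shows "\<exists>B. spectral_family (index_set n1 n2 (block_size p)) B (index_set n1 n2 (block_size p)) (circulant_vector w n1 n2)
      (\<lambda>(m1, m2, t). \<alpha> (grid_point n1 m1, grid_point n2 m2) t) \<and>
    (\<forall>a1 a2 k b1 b2 l. (a1, a2, k) \<in> index_set n1 n2 (block_size p) - boundary_set n1 n2 (block_size p) \<longrightarrow>
      (b1, b2, l) \<in> index_set n1 n2 (block_size p) - boundary_set n1 n2 (block_size p) \<longrightarrow>
      B (a1, a2, k) (b1, b2, l) = complex_of_real (dg_coeff p (int a1 - int b1, int a2 - int b2) $$ (k, l)))"
proof -
  define s where "s = block_size p"
  define \<beta> where "\<beta> = (\<lambda>(m1, m2, t). \<alpha> (grid_point n1 m1, grid_point n2 m2) t)"
  define u where "u = circulant_vector w n1 n2"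
  have ws: "spectral_family {..<s} (\<lambda>x y. dg_symbol p \<theta> $$ (x, y)) {..<s} (w \<theta>) (\<alpha> \<theta>)" for \<theta>
    unfolding s_def by (rule w)
  \<comment> \<open>The comparison matrix is defined by its expansion, so its eigenvalues are known
    by construction; what has to be proved is completeness and the value of the interior
    entries.\<close>
  define B where "B x y = (\<Sum>j\<in>index_set n1 n2 s. complex_of_real (\<beta> j) * (u j x * cnj (u j y)))" for x y
  have n12: "complex_of_nat (n1 * n2) \<noteq> 0" using n by simp
  have unit: "(\<Sum>j\<in>index_set n1 n2 s. u j x * cnj (u j y)) = of_bool (x = y)"
    if "x \<in> index_set n1 n2 s" "y \<in> index_set n1 n2 s" for x y
  proof -
    obtain a1 a2 k b1 b2 l where xy: "x = (a1, a2, k)" "y = (b1, b2, l)" by (cases x; cases y) auto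
    have b: "a1 < n1" "a2 < n2" "k < s" "b1 < n1" "b2 < n2" "l < s" using that by (auto simp: xy index_set_def)
    have "(\<Sum>t<s. 1 * (w \<theta> t k * cnj (w \<theta> t l))) = of_bool (k = l)" for \<theta>
      using ws[of \<theta>] b by (simp add: spectral_family_def)
    from circulant_vector_sum[where w = w and c = "\<lambda>_ _. 1" and ?a1.0 = a1 and ?a2.0 = a2 and ?b1.0 = b1 and ?b2.0 = b2, OF n this]
    have "(\<Sum>j\<in>index_set n1 n2 s. u j x * cnj (u j y))
      = (\<Sum>m1<n1. \<Sum>m2<n2. fourier_mode (int b1 - int a1, int b2 - int a2) (grid_point n1 m1, grid_point n2 m2)) * of_bool (k = l) / of_nat (n1 * n2)"
      by (simp add: u_def xy split_def sum_distrib_right)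
    also have "\<dots> = of_bool ((int b1 - int a1, int b2 - int a2) = (0, 0)) * of_bool (k = l)"
      using b n12 by (subst sum_fourier_mode_grid) auto
    also have "\<dots> = of_bool (x = y)" by (auto simp: xy)
    finally show ?thesis .
  qed
  have entry: "B (a1, a2, k) (b1, b2, l) = complex_of_real (dg_coeff p (int a1 - int b1, int a2 - int b2) $$ (k, l))"
    if x: "(a1, a2, k) \<in> index_set n1 n2 s - boundary_set n1 n2 s"
      and y: "(b1, b2, l) \<in> index_set n1 n2 s - boundary_set n1 n2 s" for a1 a2 k b1 b2 l
  proof -
    have b: "1 \<le> a1" "a1 + 1 < n1" "1 \<le> a2" "a2 + 1 < n2" "k < s" "1 \<le> b1" "b1 + 1 < n1" "1 \<le> b2" "b2 + 1 < n2" "l < s"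
      using x y by (auto simp: index_set_def boundary_set_def)
    define c where "c j = complex_of_real (dg_coeff p j $$ (k, l))" for j
    have "(\<Sum>t<s. complex_of_real (\<alpha> \<theta> t) * (w \<theta> t k * cnj (w \<theta> t l))) = (\<Sum>j\<in>stencil. c j * fourier_mode j \<theta>)" for \<theta>
      using ws[of \<theta>] b index_dg_symbol[of k p l \<theta>, folded s_def] by (simp add: spectral_family_def c_def)
    from circulant_vector_sum[where w = w and c = "\<lambda>\<theta> t. complex_of_real (\<alpha> \<theta> t)" and ?a1.0 = a1 and ?a2.0 = a2 and ?b1.0 = b1 and ?b2.0 = b2, OF n this]
    have "B (a1, a2, k) (b1, b2, l) = (\<Sum>m1<n1. \<Sum>m2<n2. fourier_mode (int b1 - int a1, int b2 - int a2) (grid_point n1 m1, grid_point n2 m2)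
        * (\<Sum>j\<in>stencil. c j * fourier_mode j (grid_point n1 m1, grid_point n2 m2))) / of_nat (n1 * n2)"
      by (simp add: B_def u_def \<beta>_def split_def)
    also have "\<dots> = (\<Sum>m1<n1. \<Sum>m2<n2. \<Sum>j\<in>stencil. c j * fourier_mode (fst j + (int b1 - int a1), snd j + (int b2 - int a2)) (grid_point n1 m1, grid_point n2 m2)) / of_nat (n1 * n2)"
      unfolding sum_distrib_left
      by (intro arg_cong2[where f = divide] sum.cong refl) (simp add: fourier_mode_add mult_ac)
    also have "\<dots> = (\<Sum>j\<in>stencil. c j * (\<Sum>m1<n1. \<Sum>m2<n2. fourier_mode (fst j + (int b1 - int a1), snd j + (int b2 - int a2)) (grid_point n1 m1, grid_point n2 m2))) / of_nat (n1 * n2)"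
      by (simp only: sum_distrib_left sum.swap[of _ stencil])
    also have "\<dots> = (\<Sum>j\<in>stencil. if j = (int a1 - int b1, int a2 - int b2) then c j * of_nat (n1 * n2) else 0) / of_nat (n1 * n2)"
    proof (intro arg_cong2[where f = divide] sum.cong refl)
      fix j assume "j \<in> stencil"
      then have "\<bar>fst j\<bar> \<le> 1" "\<bar>snd j\<bar> \<le> 1" using stencil_bound[of "fst j" "snd j"] by auto
      \<comment> \<open>Interior coordinates differ by at most n - 3 in each direction and the
        stencil adds at most 1, so no frequency reaches the period \<open>n\<close>.\<close>
      then have "\<bar>fst j + (int b1 - int a1)\<bar> < int n1" "\<bar>snd j + (int b2 - int a2)\<bar> < int n2" using b by auto
      from sum_fourier_mode_grid[OF this]
      show "c j * (\<Sum>m1<n1. \<Sum>m2<n2. fourier_mode (fst j + (int b1 - int a1), snd j + (int b2 - int a2)) (grid_point n1 m1, grid_point n2 m2))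
        = (if j = (int a1 - int b1, int a2 - int b2) then c j * of_nat (n1 * n2) else 0)"
        by (cases j) auto
    qed
    also have "\<dots> = c (int a1 - int b1, int a2 - int b2)"
      using dg_coeff_outside_stencil[of "(int a1 - int b1, int a2 - int b2)" p] b n12
      by (auto simp: finite_stencil c_def s_def)
    finally show ?thesis by (simp add: c_def)
  qed
  have sf: "spectral_family (index_set n1 n2 s) B (index_set n1 n2 s) u \<beta>"
    unfolding spectral_family_def using unit by (simp add: finite_index_set B_def)
  show ?thesis
    by (intro exI[of _ B] conjI allI impI sf[unfolded s_def u_def \<beta>_def] entry[unfolded s_def])
qed

text \<open>Moves the expansion of the pressure matrix from flat indices to triples, since
  interlacing compares two matrices on one index set.\<close>

lemma spectral_family_reindex:
  assumes "spectral_family I A J w \<alpha>" "inj_on e I'" "e ` I' = I" "finite I'"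
  shows "spectral_family I' (\<lambda>x y. A (e x) (e y)) J (\<lambda>j x. w j (e x)) \<alpha>"
proof -
  have "card I' = card I" using assms(2,3) card_image by metis
  then show ?thesis
    using assms unfolding spectral_family_def by (auto simp: inj_on_def)
qed

lemma image_flat_index: "flat_index n2 s ` index_set n1 n2 s = {..<n1 * n2 * s}"
proof
  show "flat_index n2 s ` index_set n1 n2 s \<subseteq> {..<n1 * n2 * s}"
    using flat_index_decode(1)[of _ _ _ n1 n2 s] by auto
  show "{..<n1 * n2 * s} \<subseteq> flat_index n2 s ` index_set n1 n2 s"
    using flat_index_encode[of _ n1 n2 s] by (metis image_eqI lessThan_iff subsetI)
qed

section \<open>The eigenvalue distribution\<close>

lemma pressure_matrix_hermitian:
  assumes "pressure_matrix p n1 n2 K"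
  shows "mat_adjoint (cmat K) = cmat K"
proof -
  have K: "K \<in> carrier_mat (n1 * n2 * block_size p) (n1 * n2 * block_size p)" "transpose_mat K = K"
    using assms by (simp_all add: pressure_matrix_def)
  have "K $$ (j, i) = K $$ (i, j)" if "i < n1 * n2 * block_size p" "j < n1 * n2 * block_size p" for i j
    using arg_cong[OF K(2), of "\<lambda>M. M $$ (i, j)"] K(1) that by simp
  then show ?thesis
    unfolding mat_adjoint_eq[OF map_carrier_mat[THEN iffD2, OF K(1)]] using K(1) by (intro eq_matI) auto
qed

text \<open>\<open>C\<close> is chosen before the grid and the matrix: the boundary rows enter only
  through their number, so the bound is uniform over all boundary conditions.\<close>

lemma pressure_matrix_eigenvalue_sum:
  fixes \<Phi> :: "complex \<Rightarrow> complex" and \<epsilon> :: real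
  assumes \<Phi>: "continuous_on UNIV \<Phi>" "compact (closure {z. \<Phi> z \<noteq> 0})" and "0 < \<epsilon>"
  shows "\<exists>C::real. 0 \<le> C \<and> (\<forall>n1 n2 K. 0 < n1 \<longrightarrow> 0 < n2 \<longrightarrow> pressure_matrix p n1 n2 K \<longrightarrow>
      norm ((\<Sum>z\<in>#eigenvalue_mset (cmat K). \<Phi> z)
        - (\<Sum>m1<n1. \<Sum>m2<n2. \<Sum>z\<in>#eigenvalue_mset (dg_symbol p (grid_point n1 m1, grid_point n2 m2)). \<Phi> z))
      \<le> \<epsilon> * real (n1 * n2 * block_size p) + C * real (n1 + n2))"
proof -
  define s where "s = block_size p"
  define \<phi> where "\<phi> x = \<Phi> (complex_of_real x)" for x
  obtain R where R: "continuous_on UNIV \<phi>" "\<And>x. R < \<bar>x\<bar> \<Longrightarrow> \<phi> x = 0"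
    using compact_support_on_reals[OF \<Phi>] unfolding \<phi>_def by blast
  have "0 < \<epsilon> / 2" using \<open>0 < \<epsilon>\<close> by simp
  obtain C :: real where C: "0 \<le> C"
    "\<forall>(J :: nat set) (J' :: (nat \<times> nat \<times> nat) set) (\<alpha> :: nat \<Rightarrow> real) (\<beta> :: nat \<times> nat \<times> nat \<Rightarrow> real) (r :: nat).
       finite J \<longrightarrow> finite J' \<longrightarrow>
       (\<forall>t. card {j\<in>J. \<alpha> j < t} \<le> card {j\<in>J'. \<beta> j < t} + r) \<longrightarrow>
       (\<forall>t. card {j\<in>J'. \<beta> j < t} \<le> card {j\<in>J. \<alpha> j < t} + r) \<longrightarrow>
       norm ((\<Sum>j\<in>J. \<phi> (\<alpha> j)) - (\<Sum>j\<in>J'. \<phi> (\<beta> j))) \<le> \<epsilon> / 2 * (card J + card J') + C * r"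
    by (rule exE[OF sum_bound_from_counts[where ?'j = nat and ?'k = "nat \<times> nat \<times> nat" and R = R, OF R \<open>0 < \<epsilon> / 2\<close>]],
        assumption, erule conjE, rule that, assumption+)
  have sum_eig: "(\<Sum>z\<in>#image_mset (\<lambda>j. complex_of_real (\<alpha> j)) (mset_set J). \<Phi> z) = (\<Sum>j\<in>J. \<phi> (\<alpha> j))" for \<alpha> and J :: "nat set"
    by (simp add: \<phi>_def image_mset.compositionality comp_def sum_unfold_sum_mset)
  \<comment> \<open>Vectors and eigenvalues are chosen as one pair, so that a single use of choice
    provides compatible families for all \<theta>.\<close>
  define P where "P \<theta> w \<alpha> \<longleftrightarrow> spectral_family {..<s} (\<lambda>x y. dg_symbol p \<theta> $$ (x, y)) {..<s} w \<alpha> \<and>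
      eigenvalue_mset (dg_symbol p \<theta>) = image_mset (\<lambda>j. complex_of_real (\<alpha> j)) (mset_set {..<s})" for \<theta> w \<alpha>
  have "\<exists>x. P \<theta> (fst x) (snd x)" for \<theta>
  proof -
    obtain w \<alpha> where "spectral_family {..<s} (\<lambda>x y. dg_symbol p \<theta> $$ (x, y)) {..<s} w \<alpha>"
      "eigenvalue_mset (dg_symbol p \<theta>) = image_mset (\<lambda>j. complex_of_real (\<alpha> j)) (mset_set {..<s})"
      unfolding s_def by (rule hermitian_spectral_family[OF dg_symbol_carrier mat_adjoint_dg_symbol])
    then have "P \<theta> (fst (w, \<alpha>)) (snd (w, \<alpha>))" by (simp add: P_def)
    then show ?thesis by (rule exI)
  qed
  then obtain x where x: "\<And>\<theta>. P \<theta> (fst (x \<theta>)) (snd (x \<theta>))" using choice[of "\<lambda>\<theta> x. P \<theta> (fst x) (snd x)"] by blast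
  define w where "w \<theta> = fst (x \<theta>)" for \<theta>
  define \<alpha> where "\<alpha> \<theta> = snd (x \<theta>)" for \<theta>
  have w: "spectral_family {..<s} (\<lambda>x y. dg_symbol p \<theta> $$ (x, y)) {..<s} (w \<theta>) (\<alpha> \<theta>)"
    and \<alpha>: "eigenvalue_mset (dg_symbol p \<theta>) = image_mset (\<lambda>j. complex_of_real (\<alpha> \<theta> j)) (mset_set {..<s})" for \<theta>
    using x[of \<theta>] unfolding P_def w_def \<alpha>_def by blast+
  show ?thesis
  \<comment> \<open>The factor \<open>2 * s\<close> comes from the bound on the number of boundary
    unknowns.\<close>
  proof (intro exI[of _ "C * real (2 * s)"] conjI allI impI)
    show "0 \<le> C * real (2 * s)" using C(1) by simp
    fix n1 n2 K assume n: "0 < n1" "0 < n2" and K: "pressure_matrix p n1 n2 K"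
    define I where "I = index_set n1 n2 s"
    define S where "S = boundary_set n1 n2 s"
    define e where "e = flat_index n2 s"
    define \<beta> where "\<beta> = (\<lambda>(m1, m2, t). \<alpha> (grid_point n1 m1, grid_point n2 m2) t)"
    have Kc: "cmat K \<in> carrier_mat (n1 * n2 * s) (n1 * n2 * s)" using K by (simp add: pressure_matrix_def s_def)
    obtain B where B: "spectral_family I B I (circulant_vector w n1 n2) \<beta>"
      and Bentry: "\<forall>a1 a2 k b1 b2 l. (a1, a2, k) \<in> I - S \<longrightarrow> (b1, b2, l) \<in> I - S \<longrightarrow>
        B (a1, a2, k) (b1, b2, l) = complex_of_real (dg_coeff p (int a1 - int b1, int a2 - int b2) $$ (k, l))"
      by (rule exE[OF circulant_spectral_family[OF n w[unfolded s_def], folded s_def, folded I_def S_def \<beta>_def]],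
          erule conjE, rule that, assumption+)
    obtain v \<gamma> where v: "spectral_family {..<n1 * n2 * s} (\<lambda>x y. cmat K $$ (x, y)) {..<n1 * n2 * s} v \<gamma>"
      and \<gamma>: "eigenvalue_mset (cmat K) = image_mset (\<lambda>j. complex_of_real (\<gamma> j)) (mset_set {..<n1 * n2 * s})"
      by (rule hermitian_spectral_family[OF Kc pressure_matrix_hermitian[OF K]], rule that, assumption+)
    have A: "spectral_family I (\<lambda>x y. cmat K $$ (e x, e y)) {..<n1 * n2 * s} (\<lambda>j x. v j (e x)) \<gamma>"
      unfolding I_def e_def
      by (rule spectral_family_reindex[OF v inj_on_flat_index image_flat_index finite_index_set])
    have SI: "S \<subseteq> I" by (simp add: S_def I_def boundary_subset)
    have eq: "cmat K $$ (e x, e y) = B x y" if "x \<in> I - S" "y \<in> I - S" for x y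
    proof -
      obtain a1 a2 k b1 b2 l where xy: "x = (a1, a2, k)" "y = (b1, b2, l)" by (cases x; cases y) auto
      have "e x < n1 * n2 * s" "e y < n1 * n2 * s"
        using that image_flat_index[of n2 s n1] by (auto simp: e_def I_def)
      then have "cmat K $$ (e x, e y) = complex_of_real (K $$ (e x, e y))" using Kc by simp
      also have "K $$ (e x, e y) = dg_coeff p (int a1 - int b1, int a2 - int b2) $$ (k, l)"
        using pressure_matrix_interior_row[OF K, of a1 a2 k b1 b2 l] that
        by (simp add: xy e_def I_def S_def s_def)
      finally show ?thesis using Bentry that by (simp add: xy)
    qed
    have "norm ((\<Sum>j<n1 * n2 * s. \<phi> (\<gamma> j)) - (\<Sum>j\<in>I. \<phi> (\<beta> j)))
        \<le> \<epsilon> / 2 * (card {..<n1 * n2 * s} + card I) + C * card S"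
    proof (rule C(2)[rule_format])
      show "card {j \<in> {..<n1 * n2 * s}. \<gamma> j < t} \<le> card {j \<in> I. \<beta> j < t} + card S" for t
        by (rule eigenvalue_count_interlacing[OF A B SI eq])
      show "card {j \<in> I. \<beta> j < t} \<le> card {j \<in> {..<n1 * n2 * s}. \<gamma> j < t} + card S" for t
        by (rule eigenvalue_count_interlacing[OF B A SI eq[symmetric]])
    qed (simp_all add: I_def finite_index_set)
    also have "\<dots> \<le> \<epsilon> * real (n1 * n2 * s) + C * real (2 * s * (n1 + n2))"
    proof -
      have "\<epsilon> / 2 * (card {..<n1 * n2 * s} + card I) = \<epsilon> * real (n1 * n2 * s)"
        by (simp add: I_def card_index_set)
      moreover have "C * card S \<le> C * real (2 * s * (n1 + n2))"
        unfolding S_def using C(1) card_boundary_set[of n1 n2 s]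
        by (intro mult_left_mono) (simp_all only: of_nat_le_iff)
      ultimately show ?thesis by linarith
    qed
    finally have "norm ((\<Sum>j<n1 * n2 * s. \<phi> (\<gamma> j)) - (\<Sum>j\<in>I. \<phi> (\<beta> j)))
        \<le> \<epsilon> * real (n1 * n2 * s) + C * real (2 * s) * real (n1 + n2)" by (simp only: of_nat_mult mult.assoc)
    moreover have "(\<Sum>z\<in>#eigenvalue_mset (cmat K). \<Phi> z) = (\<Sum>j<n1 * n2 * s. \<phi> (\<gamma> j))"
      unfolding \<gamma> by (rule sum_eig)
    moreover have "(\<Sum>m1<n1. \<Sum>m2<n2. \<Sum>z\<in>#eigenvalue_mset (dg_symbol p (grid_point n1 m1, grid_point n2 m2)). \<Phi> z)
        = (\<Sum>j\<in>I. \<phi> (\<beta> j))"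
      unfolding \<alpha> sum_eig I_def index_set_def \<beta>_def
      by (simp only: sum.cartesian_product prod.case_distrib)
    ultimately show "norm ((\<Sum>z\<in>#eigenvalue_mset (cmat K). \<Phi> z)
        - (\<Sum>m1<n1. \<Sum>m2<n2. \<Sum>z\<in>#eigenvalue_mset (dg_symbol p (grid_point n1 m1, grid_point n2 m2)). \<Phi> z))
      \<le> \<epsilon> * real (n1 * n2 * block_size p) + C * real (2 * s) * real (n1 + n2)"
      by (simp only: s_def)
  qed
qed

text \<open>The relative error is at most an arbitrarily small constant plus a multiple of (n1 + n2)
  / (n1 n2) = 1/n1 + 1/n2, which tends to 0 because both dimensions grow along
  \<open>min_at_top\<close>.\<close>

theorem pressure_matrix_eigenvalue_distribution:
  assumes K: "\<forall>n1\<ge>1. \<forall>n2\<ge>1. pressure_matrix p n1 n2 (K (n1, n2))"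
  shows "eigenvalue_distributed min_at_top (\<lambda>n. cmat (K n)) (block_size p) (dg_symbol p) symbol_domain"
  unfolding eigenvalue_distributed_def
proof (intro conjI allI ballI impI)
  define s where "s = block_size p"
  have spos: "0 < s" by (simp add: s_def)
  show "symbol_domain \<in> lmeasurable" by (rule symbol_domain_lmeasurable)
  show "0 < measure lebesgue symbol_domain" by (simp add: measure_symbol_domain)
  show "dg_symbol p \<theta> \<in> carrier_mat (block_size p) (block_size p)" for \<theta> by (rule dg_symbol_carrier)
  show "(\<lambda>\<theta>. dg_symbol p \<theta> $$ (k, l)) \<in> borel_measurable (lebesgue_on symbol_domain)"
    if "k < block_size p" "l < block_size p" for k l
    by (rule continuous_imp_measurable_on_sets_lebesgue[OF continuous_on_dg_symbol[OF that]])
      (use symbol_domain_lmeasurable in auto)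
  have dim: "cmat (K (n1, n2)) \<in> carrier_mat (n1 * n2 * s) (n1 * n2 * s)" if "1 \<le> n1" "1 \<le> n2" for n1 n2
    using K that by (simp add: pressure_matrix_def s_def)
  show "\<forall>\<^sub>F n in min_at_top. square_mat (cmat (K n))"
    unfolding eventually_min_at_top
  proof (intro exI[of _ 1] allI impI)
    fix n1 n2 :: nat assume "1 \<le> n1" "1 \<le> n2"
    from dim[OF this] show "square_mat (cmat (K (n1, n2)))" by simp
  qed
  fix \<Phi> :: "complex \<Rightarrow> complex"
  assume "continuous_on UNIV \<Phi> \<and> compact (closure {z. \<Phi> z \<noteq> 0})"
  then have \<Phi>: "continuous_on UNIV \<Phi>" "compact (closure {z. \<Phi> z \<noteq> 0})" by auto
  define h where "h \<theta> = (\<Sum>z\<in>#eigenvalue_mset (dg_symbol p \<theta>). \<Phi> z)" for \<theta>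
  have conth: "continuous_on UNIV h"
    unfolding h_def
    by (rule continuous_on_eigenvalue_sum[OF dg_symbol_carrier mat_adjoint_dg_symbol continuous_on_dg_symbol \<Phi>])
  define X where "X n = (\<Sum>z\<in>#eigenvalue_mset (cmat (K n)). \<Phi> z) / of_nat (dim_row (cmat (K n)))" for n
  define Y where "Y = (\<lambda>(n1, n2). (\<Sum>m1<n1. \<Sum>m2<n2. h (grid_point n1 m1, grid_point n2 m2) / of_nat s) / of_nat (n1 * n2))"
  have limY: "(Y \<longlongrightarrow> (LINT \<theta>|lebesgue_on symbol_domain. h \<theta> / of_nat s) / complex_of_real (measure lebesgue symbol_domain)) min_at_top"
    unfolding Y_def by (rule grid_average_tendsto) (use spos in \<open>intro continuous_intros conth, simp\<close>)
  have "((\<lambda>n. X n - Y n) \<longlongrightarrow> 0) min_at_top"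
  proof (rule tendstoI)
    fix e :: real assume "0 < e"
    then have e2: "0 < e / 2" by simp
    obtain C :: real where C: "0 \<le> C"
      "\<forall>n1 n2 K. 0 < n1 \<longrightarrow> 0 < n2 \<longrightarrow> pressure_matrix p n1 n2 K \<longrightarrow>
        norm ((\<Sum>z\<in>#eigenvalue_mset (cmat K). \<Phi> z)
          - (\<Sum>m1<n1. \<Sum>m2<n2. \<Sum>z\<in>#eigenvalue_mset (dg_symbol p (grid_point n1 m1, grid_point n2 m2)). \<Phi> z))
        \<le> e / 2 * real (n1 * n2 * block_size p) + C * real (n1 + n2)"
      by (rule exE[OF pressure_matrix_eigenvalue_sum[OF \<Phi> e2, of p]], erule conjE, rule that, assumption+)
    \<comment> \<open>This threshold makes the boundary term at most half of the tolerance: 4 C is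
      below e n1 and below e n2, and multiplying each bound by the other dimension and adding gives
      C (n1 + n2) < (e / 2) n1 n2.\<close>
    have "4 * C / e < real (nat \<lceil>4 * C / e\<rceil> + 1)" using real_nat_ceiling_ge[of "4 * C / e"] by linarith
    then obtain m :: nat where m: "4 * C / e < real m" by (rule that)
    show "\<forall>\<^sub>F n in min_at_top. dist (X n - Y n) 0 < e"
      unfolding eventually_min_at_top
    proof (intro exI[of _ "Suc m"] allI impI)
      fix n1 n2 assume n: "Suc m \<le> n1" "Suc m \<le> n2"
      then have pos: "0 < n1" "0 < n2" "1 \<le> n1" "1 \<le> n2" by auto
      define D where "D = (\<Sum>z\<in>#eigenvalue_mset (cmat (K (n1, n2))). \<Phi> z) - (\<Sum>m1<n1. \<Sum>m2<n2. h (grid_point n1 m1, grid_point n2 m2))"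
      have D: "norm D \<le> e / 2 * real (n1 * n2 * s) + C * real (n1 + n2)"
      proof -
        have "pressure_matrix p n1 n2 (K (n1, n2))" using K pos by blast
        then show ?thesis unfolding D_def h_def s_def by (rule C(2)[rule_format, OF pos(1,2)])
      qed
      have "X (n1, n2) - Y (n1, n2) = D / of_nat (n1 * n2 * s)"
        using dim[OF pos(3,4)] pos spos
        by (simp add: X_def Y_def D_def diff_divide_distrib mult_ac flip: sum_divide_distrib)
      then have "norm (X (n1, n2) - Y (n1, n2)) = norm D / real (n1 * n2 * s)"
        by (simp only: norm_divide norm_of_nat)
      also have "\<dots> < e"
      proof -
        have large: "4 * C < e * real n1" "4 * C < e * real n2"
        proof -
          have "4 * C < e * real m" using m \<open>0 < e\<close> by (simp add: field_simps)
          moreover have "e * real m \<le> e * real n1" "e * real m \<le> e * real n2"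
            using n \<open>0 < e\<close> by (auto intro!: mult_left_mono)
          ultimately show "4 * C < e * real n1" "4 * C < e * real n2" by linarith+
        qed
        have "4 * C * real n1 < e * real n2 * real n1" "4 * C * real n2 < e * real n1 * real n2"
          using large pos by (simp_all add: mult_strict_right_mono)
        then have "C * real (n1 + n2) < e / 2 * (real n1 * real n2)" by (simp add: algebra_simps)
        also have "\<dots> \<le> e / 2 * (real n1 * real n2 * real s)"
          using \<open>0 < e\<close> spos mult_left_mono[of 1 "real s" "real n1 * real n2"] by (intro mult_left_mono) auto
        finally have "norm D < e * real (n1 * n2 * s)" using D by (simp add: algebra_simps)
        then show ?thesis using pos spos by (simp add: divide_less_eq)
      qed
      finally show "dist (X (n1, n2) - Y (n1, n2)) 0 < e" by simp
    qed
  qed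
  from tendsto_add[OF this limY]
  show "((\<lambda>n. (\<Sum>z\<in>#eigenvalue_mset (cmat (K n)). \<Phi> z) / of_nat (dim_row (cmat (K n))))
      \<longlongrightarrow> (LINT \<theta>|lebesgue_on symbol_domain. (\<Sum>z\<in>#eigenvalue_mset (dg_symbol p \<theta>). \<Phi> z) / of_nat (block_size p))
        / complex_of_real (measure lebesgue symbol_domain)) min_at_top"
    unfolding X_def h_def s_def by simp
qed

section \<open>The rank bound in terms of the number of elements\<close>

text \<open>The sum n1 + n2 is not bounded by a fixed multiple of sqrt(n1 n2) over all grids (take
  n2 = 1), so the constant has to depend on a bound \<kappa> for the aspect ratio. Each of the two
  terms is at most the square root of \<kappa> x y.\<close>

lemma sum_le_sqrt_prod:
  fixes x y \<kappa> :: real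
  assumes "0 \<le> x" "0 \<le> y" "x \<le> \<kappa> * y" "y \<le> \<kappa> * x"
  shows "x + y \<le> 2 * sqrt \<kappa> * sqrt (x * y)"
proof -
  have "x = sqrt (x * x)" "y = sqrt (y * y)" using assms by simp_all
  moreover have "x * x \<le> \<kappa> * (x * y)" "y * y \<le> \<kappa> * (x * y)"
    using mult_left_mono[OF assms(3,1)] mult_left_mono[OF assms(4,2)] by (simp_all add: mult_ac)
  ultimately have "x \<le> sqrt (\<kappa> * (x * y))" "y \<le> sqrt (\<kappa> * (x * y))"
    by (metis real_sqrt_le_mono)+
  then show ?thesis by (simp add: real_sqrt_mult)
qed

theorem mainTheorem1:
  fixes p :: nat
  shows
    "(\<forall>\<theta>\<in>symbol_domain. mat_adjoint (dg_symbol p \<theta>) = dg_symbol p \<theta>) \<and>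
     transpose_mat (dg_coeff p (0, 0)) = dg_coeff p (0, 0) \<and>
     transpose_mat (dg_coeff p (-1, 0)) = dg_coeff p (1, 0) \<and>
     transpose_mat (dg_coeff p (0, -1)) = dg_coeff p (0, 1) \<and>
     (\<exists>(c :: real) (d :: real \<Rightarrow> real).
        \<forall>K :: nat \<times> nat \<Rightarrow> real mat.
          (\<forall>n1\<ge>1. \<forall>n2\<ge>1. pressure_matrix p n1 n2 (K (n1, n2))) \<longrightarrow>
          (\<forall>n1\<ge>1. \<forall>n2\<ge>1. \<exists>E \<in> carrier_mat (n1 * n2 * block_size p) (n1 * n2 * block_size p).
             cmat (K (n1, n2)) = toeplitz2 (block_size p) n1 n2 (dg_symbol p) + E \<and>
             real (vec_space.rank (n1 * n2 * block_size p) E) \<le> c * real (n1 + n2) \<and>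
             (\<forall>\<kappa>\<ge>1. real n1 \<le> \<kappa> * real n2 \<and> real n2 \<le> \<kappa> * real n1 \<longrightarrow>
                real (vec_space.rank (n1 * n2 * block_size p) E) \<le> d \<kappa> * sqrt (real (n1 * n2)))) \<and>
          eigenvalue_distributed min_at_top (\<lambda>n. cmat (K n)) (block_size p)
            (dg_symbol p) symbol_domain)"
proof (intro conjI ballI)
  define c where "c = real (2 * block_size p)"
  show "\<exists>(c :: real) (d :: real \<Rightarrow> real).
        \<forall>K :: nat \<times> nat \<Rightarrow> real mat.
          (\<forall>n1\<ge>1. \<forall>n2\<ge>1. pressure_matrix p n1 n2 (K (n1, n2))) \<longrightarrow>
          (\<forall>n1\<ge>1. \<forall>n2\<ge>1. \<exists>E \<in> carrier_mat (n1 * n2 * block_size p) (n1 * n2 * block_size p).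
             cmat (K (n1, n2)) = toeplitz2 (block_size p) n1 n2 (dg_symbol p) + E \<and>
             real (vec_space.rank (n1 * n2 * block_size p) E) \<le> c * real (n1 + n2) \<and>
             (\<forall>\<kappa>\<ge>1. real n1 \<le> \<kappa> * real n2 \<and> real n2 \<le> \<kappa> * real n1 \<longrightarrow>
                real (vec_space.rank (n1 * n2 * block_size p) E) \<le> d \<kappa> * sqrt (real (n1 * n2)))) \<and>
          eigenvalue_distributed min_at_top (\<lambda>n. cmat (K n)) (block_size p)
            (dg_symbol p) symbol_domain"
  \<comment> \<open>Both witnesses depend on \<open>p\<close> only, the second also on \<kappa>:
    \<open>c\<close> is twice the block size, and the factor \<open>2 * sqrt \<kappa>\<close> is
    that of \<open>sum_le_sqrt_prod\<close>.\<close>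
  proof (intro exI[of _ c] exI[of _ "\<lambda>\<kappa>. c * (2 * sqrt \<kappa>)"] allI impI conjI)
    fix K :: "nat \<times> nat \<Rightarrow> real mat"
    assume K: "\<forall>n1\<ge>1. \<forall>n2\<ge>1. pressure_matrix p n1 n2 (K (n1, n2))"
    show "eigenvalue_distributed min_at_top (\<lambda>n. cmat (K n)) (block_size p) (dg_symbol p) symbol_domain"
      by (rule pressure_matrix_eigenvalue_distribution[OF K])
    fix n1 n2 :: nat assume n: "1 \<le> n1" "1 \<le> n2"
    obtain E where E: "E \<in> carrier_mat (n1 * n2 * block_size p) (n1 * n2 * block_size p)"
      "cmat (K (n1, n2)) = toeplitz2 (block_size p) n1 n2 (dg_symbol p) + E"
      "vec_space.rank (n1 * n2 * block_size p) E \<le> 2 * block_size p * (n1 + n2)"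
      using pressure_matrix_decomposition K n by blast
    have rank: "real (vec_space.rank (n1 * n2 * block_size p) E) \<le> c * real (n1 + n2)"
      unfolding c_def of_nat_mult[symmetric] using E(3) by (simp only: of_nat_le_iff)
    have "real (vec_space.rank (n1 * n2 * block_size p) E) \<le> c * (2 * sqrt \<kappa>) * sqrt (real (n1 * n2))"
      if "real n1 \<le> \<kappa> * real n2 \<and> real n2 \<le> \<kappa> * real n1" for \<kappa>
    proof -
      have "c * real (n1 + n2) \<le> c * (2 * sqrt \<kappa> * sqrt (real n1 * real n2))"
        using sum_le_sqrt_prod[of "real n1" "real n2" \<kappa>] that
        by (intro mult_left_mono) (simp_all add: c_def)
      then show ?thesis using rank by (simp only: of_nat_mult mult.assoc)
    qed
    then show "\<exists>E \<in> carrier_mat (n1 * n2 * block_size p) (n1 * n2 * block_size p).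
             cmat (K (n1, n2)) = toeplitz2 (block_size p) n1 n2 (dg_symbol p) + E \<and>
             real (vec_space.rank (n1 * n2 * block_size p) E) \<le> c * real (n1 + n2) \<and>
             (\<forall>\<kappa>\<ge>1. real n1 \<le> \<kappa> * real n2 \<and> real n2 \<le> \<kappa> * real n1 \<longrightarrow>
                real (vec_space.rank (n1 * n2 * block_size p) E) \<le> c * (2 * sqrt \<kappa>) * sqrt (real (n1 * n2)))"
      using E rank by blast
  qed
qed (simp_all add: mat_adjoint_dg_symbol transpose_dg_coeff)

end
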